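(* Consider a finite sequence $\{\mathbf{S}_k\}$ of independent random complex matrices with the same size, and assume that $$\mathbb{E}\,\mathbf{S}_k = \mathbf{0} \quad\text{and}\quad \|\mathbf{S}_k\| \leq L \quad\text{for each index } k.$$ Introduce the random matrix $\mathbf{Z} = \sum_k \mathbf{S}_k$. Let $\mathbf{V}_1$ and $\mathbf{V}_2$ be (deterministic) Hermitian matrices satisfying $$\mathbf{V}_1 \succcurlyeq \mathbb{E}(\mathbf{Z}\mathbf{Z}^* ) = \sum_k \mathbb{E}(\mathbf{S}_k\mathbf{S}_k^* ) \quad\text{and}\quad \mathbf{V}_2 \succcurlyeq \mathbb{E}(\mathbf{Z}^*\mathbf{Z}) = \sum_k \mathbb{E}(\mathbf{S}_k^*\mathbf{S}_k).$$ Define $$d = \operatorname{intdim}\begin{bmatrix} \mathbf{V}_1 & \mathbf{0} \\ \mathbf{0} & \mathbf{V}_2 \end{bmatrix} \quad\text{and}\quad v = \max\{ \|\mathbf{V}_1\|,\ \|\mathbf{V}_2\| \}.$$ Then, for $t \geq \sqrt{v} + L/3$, $$\mathbb{P}\{ \|\mathbf{Z}\| \geq t \} \leq 4d \exp\left( \frac{-t^2/2}{v + Lt/3} \right).$$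
   Context: $\|\cdot\|$ is the spectral norm, ${}^*$ is the conjugate transpose, and $\mathbf{V} \succcurlyeq \mathbf{A}$ means that $\mathbf{V} - \mathbf{A}$ is positive semidefinite. For a (nonzero) positive-semidefinite matrix $\mathbf{A}$, the intrinsic dimension is $\operatorname{intdim}(\mathbf{A}) = \operatorname{tr}(\mathbf{A}) / \|\mathbf{A}\|$. *)

theory Defs
  imports "HOL-Probability.Probability"
begin

definition ctranspose :: "complex^'n^'m \<Rightarrow> complex^'m^'n"
  where "ctranspose A = (\<chi> i j. cnj (A $ j $ i))"

definition hermitian :: "complex^'n^'n \<Rightarrow> bool"
  where "hermitian A \<longleftrightarrow> ctranspose A = A"

(* For Hermitian A the quadratic form is real, so taking Re discards nothing. *)
definition psd :: "complex^'n^'n \<Rightarrow> bool"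
  where "psd A \<longleftrightarrow>
    hermitian A \<and> (\<forall>u. 0 \<le> Re (\<Sum>i\<in>UNIV. cnj (u $ i) * (A *v u) $ i))"

definition loewner_ge :: "complex^'n^'n \<Rightarrow> complex^'n^'n \<Rightarrow> bool"
  where "loewner_ge V A \<longleftrightarrow> psd (V - A)"

(* The class norm on complex^'n^'m is the Frobenius norm. The norm on complex^'n is
   the Euclidean one, so the spectral norm is the operator norm of the action on vectors. *)
definition spectral_norm :: "complex^'n^'m \<Rightarrow> real"
  where "spectral_norm A = onorm (\<lambda>x. A *v x)"

(* Meaningful for nonzero positive-semidefinite A, whose trace is real.
   Because x / 0 = 0, the value at the zero matrix is 0. *)
definition intdim :: "complex^'n^'n \<Rightarrow> real"
  where "intdim A = Re (trace A) / spectral_norm A"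

definition block_diag ::
    "complex^'m^'m \<Rightarrow> complex^'n^'n \<Rightarrow> complex^('m + 'n)^('m + 'n)"
  where "block_diag A B = (\<chi> i j.
    case (i, j) of
      (Inl a, Inl b) \<Rightarrow> A $ a $ b
    | (Inr a, Inr b) \<Rightarrow> B $ a $ b
    | _ \<Rightarrow> 0)"

end

theory Submission
  imports Defs "HOL-Real_Asymp.Real_Asymp"
begin

text \<open>
  The Laplace transform method bounds the tail of the spectral norm of Z by the expected trace of
  an exponential, and the whole difficulty is to control E tr exp(theta Y), where Y is the
  Hermitian dilation of Z, by the trace exponential of the accumulated variance. Because the
  summands do not commute, the moment generating function does not factor. The classical remedy
  is Lieb's theorem, that A |-> tr exp(H + log A) is concave on positive definite operators. Only
  the tangent plane of this concave function at the single point A = exp W is needed, that is,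
  a positive semidefinite G (depending on H and W alone) with

    tr exp(H + X) <= tr(G exp X) for all self-adjoint X, with equality for X = W.

  The right-hand side is linear in exp X, so it can be averaged, and positivity of G then turns
  the operator inequality E exp X <= exp W into E tr exp(H + X) <= tr exp(H + W). Fubini's theorem
  and induction over the independent summands give the trace bound for the sum
  (trace_mgf_sum_le).

  The tangent plane inequality (trace_exp_tangent) comes from joint convexity of relative entropy.
  The entropy tr T (log T - log A) is the integral over s > 0 of
  <T, (L_A + s R_T)^{-1} T> - tr T / (1 + s), where L_A and R_T are left multiplication by A and right
  multiplication by T. For every operator K, completing the square bounds the quadratic form below by
  2 <K, T> - <K, (L_A + s R_T) K>, which is linear in the pair (A, T). With the K that is optimal at
  the reference point, the integral over s of these lower bounds is the tangent plane. In
  eigenbases everything becomes a finite sum of rational functions of s with elementary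
  primitives.

  All operators act on a real Euclidean space. Complex vectors are viewed as a real space with
  inner product the real part of the Hermitian one; a Hermitian matrix is then a self-adjoint
  operator whose real trace is twice its complex trace. This factor two is harmless because it
  occurs on both sides: if x is a unit eigenvector of the dilation for the eigenvalue ||Z||, so is
  i x, and x and i x are orthogonal in the real inner product (op_trace_op_exp_dilation_ge).

  The intrinsic dimension enters as follows. The dilation has trace zero, so
  2 psi(theta ||Z||) <= tr exp(theta Y) - tr 1 with psi(u) = exp u - u - 1. On the other side, the
  graph of exp on [0, g v] lies below its chord, so that tr exp(g V) - tr 1 is at most
  tr V / v * (exp(g v) - 1). Subtracting tr 1 removes the ambient dimension, and tr V / v, with
  the real trace, is at most 2 d because the norm of the block diagonal matrix is at most v. The choice theta = t / (v + L t / 3)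
  gives the exponent, and the condition t >= sqrt v + L / 3 ensures theta t >= 1, which is where
  exp u <= 4 psi(u) holds.
\<close>

section \<open>Orthonormal bases and the spectral theorem\<close>

definition orthonormal_basis :: "'a::euclidean_space set \<Rightarrow> bool"
  where "orthonormal_basis B \<longleftrightarrow>
    finite B \<and> pairwise orthogonal B \<and> (\<forall>b\<in>B. norm b = 1) \<and> span B = UNIV"

lemma orthonormal_basis_finite: "orthonormal_basis B \<Longrightarrow> finite B"
  by (simp add: orthonormal_basis_def)

lemma orthonormal_basis_Basis: "orthonormal_basis Basis"
  by (auto simp: orthonormal_basis_def pairwise_def orthogonal_def inner_Basis)

lemma orthonormal_basis_inner:
  assumes "orthonormal_basis B" "b \<in> B" "c \<in> B"
  shows "b \<bullet> c = (if b = c then 1 else 0)"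
  using assms
  by (auto simp: orthonormal_basis_def pairwise_def orthogonal_def norm_eq_1)

lemma orthonormal_basis_sum:
  assumes "orthonormal_basis B"
  shows "(\<Sum>b\<in>B. (x \<bullet> b) *\<^sub>R b) = x"
  using assms by (auto simp: orthonormal_basis_def intro!: orthonormal_basis_expand)

lemma orthonormal_basis_parseval:
  assumes "orthonormal_basis B"
  shows "(\<Sum>b\<in>B. (x \<bullet> b) * (y \<bullet> b)) = x \<bullet> y"
proof -
  have "x \<bullet> y = (\<Sum>b\<in>B. (x \<bullet> b) *\<^sub>R b) \<bullet> y"
    using orthonormal_basis_sum[OF assms] by simp
  also have "\<dots> = (\<Sum>b\<in>B. (x \<bullet> b) * (y \<bullet> b))"
    by (simp add: inner_sum_left inner_commute[of y])
  finally show ?thesis by simp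
qed

lemma orthonormal_basis_linear:
  assumes "orthonormal_basis B" "linear f"
  shows "f x = (\<Sum>b\<in>B. (x \<bullet> b) *\<^sub>R f b)"
proof -
  have "f x = f (\<Sum>b\<in>B. (x \<bullet> b) *\<^sub>R b)"
    using orthonormal_basis_sum[OF assms(1)] by simp
  then show ?thesis
    by (simp add: linear_sum[OF assms(2)] linear_cmul[OF assms(2)])
qed

text \<open>The trace over the reals. For a complex matrix acting on complex vectors it is twice the real
  part of the usual trace.\<close>
definition op_trace :: "('a::euclidean_space \<Rightarrow> 'a) \<Rightarrow> real"
  where "op_trace f = (\<Sum>b\<in>Basis. b \<bullet> f b)"

lemma op_trace_basis:
  assumes B: "orthonormal_basis B" and f: "linear f"
  shows "op_trace f = (\<Sum>b\<in>B. b \<bullet> f b)"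
proof -
  have "(\<Sum>b\<in>B. b \<bullet> f b) = (\<Sum>b\<in>B. \<Sum>c\<in>Basis. (b \<bullet> c) * (b \<bullet> f c))"
    by (intro sum.cong refl)
      (subst orthonormal_basis_linear[OF orthonormal_basis_Basis f], simp add: inner_sum_right)
  also have "\<dots> = (\<Sum>c\<in>Basis. \<Sum>b\<in>B. (c \<bullet> b) * (f c \<bullet> b))"
    by (subst sum.swap) (simp add: inner_commute)
  finally show ?thesis
    by (simp add: orthonormal_basis_parseval[OF B] op_trace_def)
qed

definition self_adjoint :: "('a::real_inner \<Rightarrow> 'a) \<Rightarrow> bool"
  where "self_adjoint A \<longleftrightarrow> linear A \<and> (\<forall>x y. A x \<bullet> y = x \<bullet> A y)"

lemma self_adjointD:
  assumes "self_adjoint A"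
  shows "linear A" "A x \<bullet> y = x \<bullet> A y"
  using assms by (auto simp: self_adjoint_def)

lemma self_adjoint_add:
  "self_adjoint A \<Longrightarrow> self_adjoint B \<Longrightarrow> self_adjoint (\<lambda>x. A x + B x)"
  by (auto simp: self_adjoint_def inner_add_left inner_add_right intro: linear_compose_add)

lemma self_adjoint_scaleR:
  "self_adjoint A \<Longrightarrow> self_adjoint (\<lambda>x. c *\<^sub>R A x)"
  by (auto simp: self_adjoint_def intro: linear_compose_scale_right)

lemma self_adjoint_sum:
  "(\<And>i. i \<in> I \<Longrightarrow> self_adjoint (A i)) \<Longrightarrow> self_adjoint (\<lambda>x. \<Sum>i\<in>I. A i x)"
  by (auto simp: self_adjoint_def inner_sum_left inner_sum_right intro: linear_compose_sum)

text \<open>The eigenvalue of a unit eigenvector b is recovered as b \<bullet> A b, so an eigenbasis needs no separate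
  list of eigenvalues.\<close>
definition eigenbasis :: "('a::euclidean_space \<Rightarrow> 'a) \<Rightarrow> 'a set \<Rightarrow> bool"
  where "eigenbasis A B \<longleftrightarrow> orthonormal_basis B \<and> (\<forall>b\<in>B. A b = (b \<bullet> A b) *\<^sub>R b)"

text \<open>The unit vectors orthogonal to the given eigenvectors form a nonempty compact set, on which the
  Rayleigh quotient has a maximizer. It is an eigenvector because the orthogonal complement is
  invariant under A.\<close>
lemma eigenvector_orthogonal_to:
  fixes A :: "'a::euclidean_space \<Rightarrow> 'a"
  assumes A: "self_adjoint A"
    and C: "\<And>c. c \<in> C \<Longrightarrow> \<exists>l. A c = l *\<^sub>R c"
    and nz: "z \<noteq> 0" "\<And>c. c \<in> C \<Longrightarrow> z \<bullet> c = 0"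
  obtains x where "norm x = 1" "\<And>c. c \<in> C \<Longrightarrow> x \<bullet> c = 0" "A x = (x \<bullet> A x) *\<^sub>R x"
proof -
  define S where "S = {x. \<forall>c\<in>C. x \<bullet> c = 0}"
  have lin: "linear A" and sym: "\<And>x y. A x \<bullet> y = x \<bullet> A y"
    using A by (auto simp: self_adjoint_def)
  have S_add: "x + y \<in> S" "r *\<^sub>R x \<in> S" if "x \<in> S" "y \<in> S" for x y r
    using that by (auto simp: S_def inner_add_left)
  have AS: "A x \<in> S" if "x \<in> S" for x
    unfolding S_def
  proof safe
    fix c assume c: "c \<in> C"
    then obtain l where "A c = l *\<^sub>R c" using C by blast
    then show "A x \<bullet> c = 0" using that c by (simp add: sym S_def)
  qed
  have "closed S"
  proof -
    have "S = (\<Inter>c\<in>C. {x. x \<bullet> c = 0})" by (auto simp: S_def)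
    then show ?thesis
      by (auto intro!: closed_INT closed_Collect_eq continuous_intros)
  qed
  then have cpt: "compact (sphere 0 1 \<inter> S)"
    by (rule compact_Int_closed[OF compact_sphere])
  have "(1 / norm z) *\<^sub>R z \<in> sphere 0 1 \<inter> S"
    using nz by (auto simp: S_def)
  then have ne: "sphere 0 1 \<inter> S \<noteq> {}" by blast
  have "continuous_on (sphere 0 1 \<inter> S) (\<lambda>x. x \<bullet> A x)"
    using linear_continuous_on[of A] lin
    by (intro continuous_intros) (auto simp: linear_conv_bounded_linear)
  from continuous_attains_sup[OF cpt ne this] obtain x
    where x: "x \<in> sphere 0 1 \<inter> S" and max: "\<And>y. y \<in> sphere 0 1 \<inter> S \<Longrightarrow> y \<bullet> A y \<le> x \<bullet> A x"
    by blast
  define l where "l = x \<bullet> A x"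
  have xx: "x \<bullet> x = 1" using x by (simp add: norm_eq_1)
  have xS: "x \<in> S" using x by blast
  have quad: "y \<bullet> A y \<le> l * (y \<bullet> y)" if "y \<in> S" for y
  proof (cases "y = 0")
    case False
    have "(1 / norm y) *\<^sub>R y \<in> sphere 0 1 \<inter> S"
      using False S_add[OF that that] by auto
    from max[OF this] have "(1 / norm y)\<^sup>2 * (y \<bullet> A y) \<le> l"
      by (simp add: l_def linear_cmul[OF lin] power2_eq_square)
    then show ?thesis
      using False by (simp add: field_simps power2_norm_eq_inner)
  qed simp
  define r where "r = A x - l *\<^sub>R x"
  have "r = A x + (- l) *\<^sub>R x" by (simp add: r_def)
  then have rS: "r \<in> S" using S_add AS xS by metis
  have "A x \<bullet> x = l" by (simp add: l_def inner_commute)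
  then have rx: "r \<bullet> x = 0"
    by (simp add: r_def inner_diff_left xx)
  (* The Rayleigh quotient is maximal at x, so moving along the residual r must not raise it to
     first order; the first-order change is a positive multiple of r \<bullet> r. *)
  have pert: "2 * e * (r \<bullet> r) \<le> e\<^sup>2 * (l * (r \<bullet> r) - r \<bullet> A r)" for e
  proof -
    have "x + e *\<^sub>R r \<in> S" using S_add xS rS by blast
    from quad[OF this]
    have "(x + e *\<^sub>R r) \<bullet> A (x + e *\<^sub>R r) \<le> l * ((x + e *\<^sub>R r) \<bullet> (x + e *\<^sub>R r))" .
    moreover have "A (x + e *\<^sub>R r) = A x + e *\<^sub>R A r"
      by (simp add: linear_add[OF lin] linear_cmul[OF lin])
    moreover have "x \<bullet> A r = r \<bullet> A x" using sym[of x r] by (simp add: inner_commute)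
    moreover have "r \<bullet> A x = r \<bullet> r" using rx by (simp add: r_def inner_diff_right algebra_simps)
    moreover have "x \<bullet> A x = l" by (simp add: l_def)
    ultimately show ?thesis
      using rx xx
      by (simp add: inner_add_left inner_add_right inner_commute[of x r] algebra_simps power2_eq_square)
  qed
  have "r = 0"
  proof (rule ccontr)
    assume "r \<noteq> 0"
    then have rr: "r \<bullet> r > 0" by simp
    obtain K where K: "l * (r \<bullet> r) - r \<bullet> A r \<le> K" "K > 0"
      by (meson gt_ex le_less_trans less_imp_le linorder_le_cases)
    have "2 * (r \<bullet> r / K) * (r \<bullet> r) \<le> (r \<bullet> r / K)\<^sup>2 * K"
      using pert[of "r \<bullet> r / K"]
      by (rule order_trans) (use K in \<open>auto intro!: mult_left_mono\<close>)
    also have "\<dots> = (r \<bullet> r / K) * (r \<bullet> r)"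
      using K(2) by (simp add: power2_eq_square)
    finally have "(r \<bullet> r / K) * (r \<bullet> r) \<le> 0" by simp
    moreover have "(r \<bullet> r / K) * (r \<bullet> r) > 0" using rr K(2) by simp
    ultimately show False by simp
  qed
  then have "A x = (x \<bullet> A x) *\<^sub>R x" by (simp add: r_def l_def)
  moreover have "norm x = 1" using x by simp
  ultimately show thesis using that[of x] xS by (auto simp: S_def)
qed

theorem eigenbasis_exists:
  fixes A :: "'a::euclidean_space \<Rightarrow> 'a"
  assumes A: "self_adjoint A"
  obtains B where "eigenbasis A B"
proof -
  have "\<exists>B. finite B \<and> card B = k \<and> pairwise orthogonal B \<and>
          (\<forall>b\<in>B. norm b = 1 \<and> A b = (b \<bullet> A b) *\<^sub>R b)" if "k \<le> DIM('a)" for k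
    using that
  proof (induction k)
    case 0
    then show ?case by (intro exI[of _ "{}"]) simp
  next
    case (Suc k)
    then obtain B where B: "finite B" "card B = k" "pairwise orthogonal B"
      "\<forall>b\<in>B. norm b = 1 \<and> A b = (b \<bullet> A b) *\<^sub>R b" by auto
    have "dim B < DIM('a)"
      using dim_le_card'[OF B(1)] B(2) Suc.prems by linarith
    then obtain z where z: "z \<noteq> 0" "\<And>y. y \<in> span B \<Longrightarrow> orthogonal z y"
      using orthogonal_to_subspace_exists by blast
    have "\<And>c. c \<in> B \<Longrightarrow> z \<bullet> c = 0" using z(2) span_base by (auto simp: orthogonal_def)
    moreover have "\<And>c. c \<in> B \<Longrightarrow> \<exists>l. A c = l *\<^sub>R c" using B(4) by blast
    ultimately obtain x where x: "norm x = 1" "\<And>c. c \<in> B \<Longrightarrow> x \<bullet> c = 0" "A x = (x \<bullet> A x) *\<^sub>R x"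
      using eigenvector_orthogonal_to[OF A _ z(1)] by metis
    have "x \<notin> B" using x(1) x(2)[of x] by (auto simp: norm_eq_1)
    have "pairwise orthogonal (insert x B)"
      unfolding pairwise_insert using B(3) x(2) by (auto simp: orthogonal_def inner_commute)
    then show ?case
      using B x(1,3) \<open>x \<notin> B\<close> by (intro exI[of _ "insert x B"]) simp
  qed
  from this[of "DIM('a)"] obtain B where B: "finite B" "card B = DIM('a)" "pairwise orthogonal B"
    "\<forall>b\<in>B. norm b = 1 \<and> A b = (b \<bullet> A b) *\<^sub>R b" by auto
  have "independent B"
    using B by (intro pairwise_orthogonal_independent) auto
  then have "span B = UNIV"
    using B card_eq_dim[of B UNIV] by (auto simp: dim_UNIV)
  then have "eigenbasis A B"
    using B by (auto simp: eigenbasis_def orthonormal_basis_def)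
  then show thesis by (rule that)
qed

lemma eigenbasisD:
  assumes "eigenbasis A B"
  shows "orthonormal_basis B" "finite B" "\<And>b. b \<in> B \<Longrightarrow> A b = (b \<bullet> A b) *\<^sub>R b"
  using assms by (auto simp: eigenbasis_def orthonormal_basis_def)

lemma eigenbasis_scaleR:
  assumes "eigenbasis A B"
  shows "eigenbasis (\<lambda>x. c *\<^sub>R A x) B"
  unfolding eigenbasis_def
proof safe
  show "orthonormal_basis B" using assms by (rule eigenbasisD)
  show "c *\<^sub>R A b = (b \<bullet> c *\<^sub>R A b) *\<^sub>R b" if "b \<in> B" for b
    unfolding inner_scaleR_right scaleR_scaleR[symmetric]
    by (rule arg_cong[OF eigenbasisD(3)[OF assms that]])
qed

section \<open>The operator exponential and its trace\<close>

text \<open>The power series makes measurability in a parameter immediate; computations use the eigenbasis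
  formula below.\<close>
definition op_exp :: "('a::real_normed_vector \<Rightarrow> 'a) \<Rightarrow> 'a \<Rightarrow> 'a"
  where "op_exp A x = (\<Sum>k. (A ^^ k) x /\<^sub>R fact k)"

lemma eigenbasis_funpow:
  assumes "eigenbasis A B" "linear A"
  shows "(A ^^ k) x = (\<Sum>b\<in>B. ((b \<bullet> A b) ^ k * (x \<bullet> b)) *\<^sub>R b)"
proof (induction k)
  case 0
  then show ?case
    using orthonormal_basis_sum[OF eigenbasisD(1)[OF assms(1)]] by simp
next
  case (Suc k)
  have "(A ^^ Suc k) x = A (\<Sum>b\<in>B. ((b \<bullet> A b) ^ k * (x \<bullet> b)) *\<^sub>R b)"
    using Suc by simp
  also have "\<dots> = (\<Sum>b\<in>B. ((b \<bullet> A b) ^ k * (x \<bullet> b)) *\<^sub>R A b)"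
    by (simp add: linear_sum[OF assms(2)] linear_cmul[OF assms(2)])
  also have "\<dots> = (\<Sum>b\<in>B. ((b \<bullet> A b) ^ Suc k * (x \<bullet> b)) *\<^sub>R b)"
    by (intro sum.cong refl, subst eigenbasisD(3)[OF assms(1)], assumption) (simp add: mult_ac)
  finally show ?case .
qed

lemma op_exp_sums_eigenbasis:
  assumes "eigenbasis A B" "linear A"
  shows "(\<lambda>k. (A ^^ k) x /\<^sub>R fact k) sums (\<Sum>b\<in>B. (exp (b \<bullet> A b) * (x \<bullet> b)) *\<^sub>R b)"
proof -
  have "(\<lambda>k. \<Sum>b\<in>B. ((b \<bullet> A b) ^ k /\<^sub>R fact k * (x \<bullet> b)) *\<^sub>R b)
      sums (\<Sum>b\<in>B. (exp (b \<bullet> A b) * (x \<bullet> b)) *\<^sub>R b)"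
    by (intro sums_sum sums_scaleR_left sums_mult2 exp_converges)
  then show ?thesis
    by (simp add: eigenbasis_funpow[OF assms] scaleR_sum_right mult_ac)
qed

lemma op_exp_eigenbasis:
  assumes "eigenbasis A B" "linear A"
  shows "op_exp A x = (\<Sum>b\<in>B. (exp (b \<bullet> A b) * (x \<bullet> b)) *\<^sub>R b)"
  using op_exp_sums_eigenbasis[OF assms] by (simp add: op_exp_def sums_iff)

lemma inner_op_exp:
  assumes "eigenbasis A B" "linear A"
  shows "x \<bullet> op_exp A x = (\<Sum>b\<in>B. exp (b \<bullet> A b) * (x \<bullet> b)\<^sup>2)"
  by (simp add: op_exp_eigenbasis[OF assms] inner_sum_right power2_eq_square mult_ac)

lemma inner_self_adjoint:
  assumes "eigenbasis A B" "linear A"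
  shows "x \<bullet> A x = (\<Sum>b\<in>B. (b \<bullet> A b) * (x \<bullet> b)\<^sup>2)"
  using eigenbasis_funpow[OF assms, of 1 x]
  by (simp add: inner_sum_right power2_eq_square mult_ac)

lemma self_adjoint_op_exp:
  fixes A :: "'a::euclidean_space \<Rightarrow> 'a"
  assumes "self_adjoint A"
  shows "self_adjoint (op_exp A)"
proof -
  obtain B where B: "eigenbasis A B" by (rule eigenbasis_exists[OF assms])
  have eq: "op_exp A = (\<lambda>x. \<Sum>b\<in>B. (exp (b \<bullet> A b) * (x \<bullet> b)) *\<^sub>R b)"
    using op_exp_eigenbasis[OF B self_adjointD(1)[OF assms]] by (auto simp: fun_eq_iff)
  show ?thesis
    unfolding eq self_adjoint_def
    by (auto intro!: linearI simp: inner_sum_left inner_sum_right inner_add_left algebra_simps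
        scaleR_sum_right sum.distrib inner_commute)
qed

lemma op_trace_op_exp:
  assumes B: "eigenbasis A B" and A: "self_adjoint A"
  shows "op_trace (op_exp A) = (\<Sum>b\<in>B. exp (b \<bullet> A b))"
proof -
  have "op_trace (op_exp A) = (\<Sum>b\<in>B. b \<bullet> op_exp A b)"
    using op_trace_basis[OF eigenbasisD(1)[OF B]] self_adjoint_op_exp[OF A]
    by (simp add: self_adjoint_def)
  also have "\<dots> = (\<Sum>b\<in>B. exp (b \<bullet> A b))"
  proof (rule sum.cong[OF refl])
    fix b assume b: "b \<in> B"
    have "b \<bullet> op_exp A b = (\<Sum>c\<in>B. if b = c then exp (c \<bullet> A c) else 0)"
      unfolding inner_op_exp[OF B self_adjointD(1)[OF A]]
      using b by (intro sum.cong) (auto simp: orthonormal_basis_inner[OF eigenbasisD(1)[OF B]])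
    then show "b \<bullet> op_exp A b = exp (b \<bullet> A b)"
      using b eigenbasisD(2)[OF B] by simp
  qed
  finally show ?thesis .
qed

lemma orthonormal_basis_norm_squared:
  assumes "orthonormal_basis B"
  shows "(\<Sum>b\<in>B. (x \<bullet> b)\<^sup>2) = x \<bullet> x"
  using orthonormal_basis_parseval[OF assms, of x x] by (simp add: power2_eq_square)

text \<open>Jensen's inequality: the squared coordinates of x in an eigenbasis of A are probability weights.\<close>
lemma exp_inner_le:
  fixes A :: "'a::euclidean_space \<Rightarrow> 'a"
  assumes A: "self_adjoint A" and x: "norm x = 1"
  shows "exp (x \<bullet> A x) \<le> x \<bullet> op_exp A x"
proof -
  obtain B where B: "eigenbasis A B" by (rule eigenbasis_exists[OF A])
  define s where "s = x \<bullet> A x"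
  note lin = self_adjointD(1)[OF A]
  have w: "(\<Sum>b\<in>B. (x \<bullet> b)\<^sup>2) = 1"
    using orthonormal_basis_norm_squared[OF eigenbasisD(1)[OF B]] x by (simp add: norm_eq_1)
  have tangent: "exp s * (1 + (l - s)) \<le> exp l" for l :: real
    using exp_ge_add_one_self[of "l - s"] mult_left_mono[of "1 + (l - s)" "exp (l - s)" "exp s"]
    by (simp flip: exp_add)
  have "exp s = (\<Sum>b\<in>B. exp s * (1 + (b \<bullet> A b - s)) * (x \<bullet> b)\<^sup>2)"
  proof -
    have "(\<Sum>b\<in>B. exp s * (1 + (b \<bullet> A b - s)) * (x \<bullet> b)\<^sup>2)
        = (\<Sum>b\<in>B. exp s * (1 - s) * (x \<bullet> b)\<^sup>2 + exp s * ((b \<bullet> A b) * (x \<bullet> b)\<^sup>2))"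
      by (intro sum.cong) (auto simp: algebra_simps)
    also have "\<dots> = exp s * (1 - s) + exp s * s"
      using w inner_self_adjoint[OF B lin, of x]
      by (simp add: sum.distrib s_def flip: sum_distrib_left)
    finally show ?thesis by (simp add: algebra_simps)
  qed
  also have "\<dots> \<le> (\<Sum>b\<in>B. exp (b \<bullet> A b) * (x \<bullet> b)\<^sup>2)"
    by (intro sum_mono mult_right_mono tangent) auto
  finally show ?thesis by (simp add: inner_op_exp[OF B lin] s_def)
qed

text \<open>The exponential is not operator monotone, but its trace is: in an eigenbasis of A, replace the
  eigenvalues of A by the larger diagonal entries of B and apply Jensen's inequality.\<close>
lemma op_trace_op_exp_mono:
  fixes A B :: "'a::euclidean_space \<Rightarrow> 'a"
  assumes A: "self_adjoint A" and B: "self_adjoint B" and le: "\<And>x. x \<bullet> A x \<le> x \<bullet> B x"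
  shows "op_trace (op_exp A) \<le> op_trace (op_exp B)"
proof -
  obtain Q where Q: "eigenbasis A Q" by (rule eigenbasis_exists[OF A])
  have "op_trace (op_exp A) = (\<Sum>q\<in>Q. exp (q \<bullet> A q))" by (rule op_trace_op_exp[OF Q A])
  also have "\<dots> \<le> (\<Sum>q\<in>Q. q \<bullet> op_exp B q)"
  proof (rule sum_mono)
    fix q assume "q \<in> Q"
    then have "norm q = 1" using eigenbasisD(1)[OF Q] by (simp add: orthonormal_basis_def)
    from exp_inner_le[OF B this] show "exp (q \<bullet> A q) \<le> q \<bullet> op_exp B q"
      using le[of q] by (meson exp_le_cancel_iff order_trans)
  qed
  also have "\<dots> = op_trace (op_exp B)"
    using op_trace_basis[OF eigenbasisD(1)[OF Q]] self_adjoint_op_exp[OF B]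
    by (simp add: self_adjoint_def)
  finally show ?thesis .
qed

text \<open>No eigenvalue of a positive semidefinite operator exceeds the sum of all of them.\<close>
lemma norm_le_op_trace:
  fixes A :: "'a::euclidean_space \<Rightarrow> 'a"
  assumes A: "self_adjoint A" and psd: "\<And>x. 0 \<le> x \<bullet> A x"
  shows "norm (A x) \<le> op_trace A * norm x"
proof -
  obtain B where B: "eigenbasis A B" by (rule eigenbasis_exists[OF A])
  note B' = eigenbasisD(1)[OF B] and lin = self_adjointD(1)[OF A]
  have tr: "op_trace A = (\<Sum>b\<in>B. b \<bullet> A b)" by (rule op_trace_basis[OF B' lin])
  then have tr0: "0 \<le> op_trace A" by (simp add: sum_nonneg psd)
  have "A x \<bullet> A x = (\<Sum>b\<in>B. (A x \<bullet> b)\<^sup>2)" by (rule orthonormal_basis_norm_squared[OF B', symmetric])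
  also have "\<dots> \<le> (\<Sum>b\<in>B. (op_trace A)\<^sup>2 * (x \<bullet> b)\<^sup>2)"
  proof (rule sum_mono)
    fix b assume b: "b \<in> B"
    have "A x \<bullet> b = x \<bullet> A b" by (rule self_adjointD(2)[OF A])
    also have "\<dots> = (b \<bullet> A b) * (x \<bullet> b)" by (subst eigenbasisD(3)[OF B b]) simp
    finally have "(A x \<bullet> b)\<^sup>2 = (b \<bullet> A b)\<^sup>2 * (x \<bullet> b)\<^sup>2" by (simp add: power_mult_distrib)
    moreover have "b \<bullet> A b \<le> op_trace A"
      unfolding tr using eigenbasisD(2)[OF B] b psd by (intro member_le_sum) auto
    ultimately show "(A x \<bullet> b)\<^sup>2 \<le> (op_trace A)\<^sup>2 * (x \<bullet> b)\<^sup>2"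
      using psd[of b] by (simp add: mult_right_mono power_mono)
  qed
  also have "\<dots> = (op_trace A * norm x)\<^sup>2"
    by (simp add: sum_distrib_left[symmetric] orthonormal_basis_norm_squared[OF B']
        power_mult_distrib power2_norm_eq_inner)
  finally have "(norm (A x))\<^sup>2 \<le> (op_trace A * norm x)\<^sup>2" by (simp add: power2_norm_eq_inner)
  then show ?thesis using tr0 by (simp add: power2_le_iff_abs_le)
qed

text \<open>With psi(l) = exp l - l - 1, the right-hand side is the trace of psi(A), a sum of nonnegative
  terms over an eigenbasis. Bessel's inequality bounds it below by the two diagonal entries of
  psi(A) at u and w, and Jensen's inequality moves psi inside. Two vectors are considered because
  the eigenvalues of a complex Hermitian matrix have even multiplicity over the reals.\<close>
lemma two_vectors_op_trace_le:
  fixes A :: "'a::euclidean_space \<Rightarrow> 'a"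
  assumes A: "self_adjoint A" and u: "norm u = 1" and w: "norm w = 1" and uw: "u \<bullet> w = 0"
  shows "(exp (u \<bullet> A u) - u \<bullet> A u - 1) + (exp (w \<bullet> A w) - w \<bullet> A w - 1)
    \<le> op_trace (op_exp A) - op_trace A - DIM('a)"
proof -
  obtain B where B: "eigenbasis A B" by (rule eigenbasis_exists[OF A])
  note B' = eigenbasisD(1)[OF B] and lin = self_adjointD(1)[OF A]
  define \<psi> where "\<psi> l = exp l - l - 1" for l :: real
  have \<psi>: "0 \<le> \<psi> l" for l unfolding \<psi>_def using exp_ge_add_one_self[of l] by linarith
  have quad: "exp (x \<bullet> A x) - x \<bullet> A x - 1 \<le> (\<Sum>b\<in>B. \<psi> (b \<bullet> A b) * (x \<bullet> b)\<^sup>2)" if "norm x = 1" for x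
  proof -
    have "(\<Sum>b\<in>B. \<psi> (b \<bullet> A b) * (x \<bullet> b)\<^sup>2) = x \<bullet> op_exp A x - x \<bullet> A x - x \<bullet> x"
      unfolding inner_op_exp[OF B lin] inner_self_adjoint[OF B lin, of x]
        orthonormal_basis_norm_squared[OF B', of x, symmetric]
      by (simp add: \<psi>_def left_diff_distrib sum_subtractf)
    then show ?thesis using exp_inner_le[OF A that] that by (simp add: norm_eq_1)
  qed
  have bessel: "(u \<bullet> b)\<^sup>2 + (w \<bullet> b)\<^sup>2 \<le> 1" if "b \<in> B" for b
  proof -
    have uu: "u \<bullet> u = 1" "w \<bullet> w = 1" "b \<bullet> b = 1" "w \<bullet> u = 0"
      using u w uw orthonormal_basis_inner[OF B' that that] by (simp_all add: norm_eq_1 inner_commute)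
    have "0 \<le> (b - (u \<bullet> b) *\<^sub>R u - (w \<bullet> b) *\<^sub>R w) \<bullet> (b - (u \<bullet> b) *\<^sub>R u - (w \<bullet> b) *\<^sub>R w)"
      by (rule inner_ge_zero)
    also have "\<dots> = 1 - (u \<bullet> b)\<^sup>2 - (w \<bullet> b)\<^sup>2"
      by (simp add: inner_diff_left inner_diff_right uu uw inner_commute[of b u] inner_commute[of b w]
          power2_eq_square)
    finally show ?thesis by simp
  qed
  have "(exp (u \<bullet> A u) - u \<bullet> A u - 1) + (exp (w \<bullet> A w) - w \<bullet> A w - 1)
      \<le> (\<Sum>b\<in>B. \<psi> (b \<bullet> A b) * ((u \<bullet> b)\<^sup>2 + (w \<bullet> b)\<^sup>2))"
    using quad[OF u] quad[OF w] by (simp add: distrib_left sum.distrib)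
  also have "\<dots> \<le> (\<Sum>b\<in>B. \<psi> (b \<bullet> A b))"
    using mult_left_mono[OF bessel \<psi>] by (intro sum_mono) simp
  also have "\<dots> = op_trace (op_exp A) - op_trace A - (\<Sum>b\<in>B. b \<bullet> b)"
    using orthonormal_basis_inner[OF B']
    by (simp add: op_trace_op_exp[OF B A] op_trace_basis[OF B' lin] \<psi>_def sum_subtractf)
  also have "(\<Sum>b\<in>B. b \<bullet> b) = DIM('a)"
    using op_trace_basis[OF B' linear_id] by (simp add: op_trace_def)
  finally show ?thesis .
qed

text \<open>On the interval [0, v] the convex function l |-> exp(g l) lies below its chord. Summing over the
  eigenvalues leaves the trace of A in place of the ambient dimension.\<close>
lemma op_trace_op_exp_le_chord:
  fixes A :: "'a::euclidean_space \<Rightarrow> 'a"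
  assumes A: "self_adjoint A" and g: "0 \<le> g" and v: "0 < v"
    and psd: "\<And>x. 0 \<le> x \<bullet> A x" and le: "\<And>x. x \<bullet> A x \<le> v * (x \<bullet> x)"
  shows "op_trace (op_exp (\<lambda>x. g *\<^sub>R A x)) - DIM('a) \<le> op_trace A / v * (exp (g * v) - 1)"
proof -
  obtain B where B: "eigenbasis A B" by (rule eigenbasis_exists[OF A])
  note B' = eigenbasisD(1)[OF B] and lin = self_adjointD(1)[OF A]
  have chord: "exp (g * l) - 1 \<le> l / v * (exp (g * v) - 1)" if "0 \<le> l" "l \<le> v" for l
    using convex_onD[OF exp_convex, of "l / v" 0 "g * v"] that v by (simp add: algebra_simps)
  have "op_trace (op_exp (\<lambda>x. g *\<^sub>R A x)) - (\<Sum>b\<in>B. b \<bullet> b) = (\<Sum>b\<in>B. exp (g * (b \<bullet> A b)) - 1)"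
    using op_trace_op_exp[OF eigenbasis_scaleR[OF B] self_adjoint_scaleR[OF A], of g]
      orthonormal_basis_inner[OF B'] by (simp add: sum_subtractf)
  also have "\<dots> \<le> (\<Sum>b\<in>B. (b \<bullet> A b) / v * (exp (g * v) - 1))"
    using psd le orthonormal_basis_inner[OF B'] by (intro sum_mono chord) (auto, metis mult.right_neutral)
  also have "\<dots> = op_trace A / v * (exp (g * v) - 1)"
    by (simp add: op_trace_basis[OF B' lin] sum_divide_distrib sum_distrib_right)
  also have "(\<Sum>b\<in>B. b \<bullet> b) = DIM('a)"
    using op_trace_basis[OF B' linear_id] by (simp add: op_trace_def)
  finally show ?thesis .
qed

section \<open>Three improper integrals\<close>

text \<open>The improper integral of f over [0, \<infinity>), for functions that have a primitive on that half line.
  All integrands below are combinations of rational functions with explicit primitives, so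
  linearity and monotonicity are all that is required of the integral.\<close>
definition has_improper_integral :: "(real \<Rightarrow> real) \<Rightarrow> real \<Rightarrow> bool"
  where "has_improper_integral f I \<longleftrightarrow>
    (\<exists>F. (\<forall>s\<ge>0. (F has_real_derivative f s) (at s)) \<and> (F \<longlongrightarrow> F 0 + I) at_top)"

lemma has_improper_integralI:
  assumes "\<And>s. s \<ge> 0 \<Longrightarrow> (F has_real_derivative f s) (at s)"
    and "(F \<longlongrightarrow> l) at_top" "I = l - F 0"
  shows "has_improper_integral f I"
  unfolding has_improper_integral_def using assms by (intro exI[of _ F]) simp

lemma has_improper_integral_cmult:
  assumes "has_improper_integral f I"
  shows "has_improper_integral (\<lambda>s. c * f s) (c * I)"
proof -
  obtain F where F: "\<And>s. s \<ge> 0 \<Longrightarrow> (F has_real_derivative f s) (at s)" "(F \<longlongrightarrow> F 0 + I) at_top"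
    using assms by (auto simp: has_improper_integral_def)
  have "((\<lambda>s. c * F s) \<longlongrightarrow> c * (F 0 + I)) at_top"
    by (rule tendsto_mult_left[OF F(2)])
  then show ?thesis
    by (rule has_improper_integralI[rotated]) (auto intro!: DERIV_cmult F(1) simp: distrib_left)
qed

lemma has_improper_integral_diff:
  assumes "has_improper_integral f I" "has_improper_integral g J"
  shows "has_improper_integral (\<lambda>s. f s - g s) (I - J)"
proof -
  obtain F where F: "\<And>s. s \<ge> 0 \<Longrightarrow> (F has_real_derivative f s) (at s)" "(F \<longlongrightarrow> F 0 + I) at_top"
    using assms by (auto simp: has_improper_integral_def)
  obtain G where G: "\<And>s. s \<ge> 0 \<Longrightarrow> (G has_real_derivative g s) (at s)" "(G \<longlongrightarrow> G 0 + J) at_top"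
    using assms by (auto simp: has_improper_integral_def)
  show ?thesis
    by (rule has_improper_integralI[of "\<lambda>s. F s - G s" _ "(F 0 + I) - (G 0 + J)"])
      (auto intro!: DERIV_diff F G tendsto_diff)
qed

lemma has_improper_integral_sum:
  assumes "\<And>i. i \<in> A \<Longrightarrow> has_improper_integral (f i) (I i)"
  shows "has_improper_integral (\<lambda>s. \<Sum>i\<in>A. f i s) (\<Sum>i\<in>A. I i)"
proof -
  have "\<forall>i\<in>A. \<exists>F. (\<forall>s\<ge>0. (F has_real_derivative f i s) (at s)) \<and> (F \<longlongrightarrow> F 0 + I i) at_top"
    using assms by (auto simp: has_improper_integral_def)
  then obtain F where F: "\<And>i s. i \<in> A \<Longrightarrow> s \<ge> 0 \<Longrightarrow> (F i has_real_derivative f i s) (at s)"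
    "\<And>i. i \<in> A \<Longrightarrow> (F i \<longlongrightarrow> F i 0 + I i) at_top"
    by metis
  have "((\<lambda>s. \<Sum>i\<in>A. F i s) \<longlongrightarrow> (\<Sum>i\<in>A. F i 0 + I i)) at_top"
    by (intro tendsto_sum F(2))
  then show ?thesis
    by (rule has_improper_integralI[rotated]) (auto intro!: DERIV_sum F(1) simp: sum.distrib)
qed

lemma has_improper_integral_nonneg:
  assumes "has_improper_integral f I" "\<And>s. s \<ge> 0 \<Longrightarrow> 0 \<le> f s"
  shows "0 \<le> I"
proof -
  obtain F where F: "\<And>s. s \<ge> 0 \<Longrightarrow> (F has_real_derivative f s) (at s)" "(F \<longlongrightarrow> F 0 + I) at_top"
    using assms by (auto simp: has_improper_integral_def)
  have "F 0 \<le> F s" if "s \<ge> 0" for s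
    using that F(1) assms(2) by (intro DERIV_nonneg_imp_nondecreasing[OF that]) auto
  then have "F 0 \<le> F 0 + I"
    by (intro tendsto_lowerbound[OF F(2)] eventually_at_top_linorderI[of 0]) auto
  then show ?thesis by simp
qed

lemma has_improper_integral_le:
  assumes "has_improper_integral f I" "has_improper_integral g J" "\<And>s. s \<ge> 0 \<Longrightarrow> f s \<le> g s"
  shows "I \<le> J"
  using has_improper_integral_nonneg[OF has_improper_integral_diff[OF assms(2,1)]] assms(3) by simp

text \<open>Multiplied by t, this represents the relative entropy t (ln t - ln a) of two numbers.\<close>
lemma has_improper_integral_ln:
  assumes "a > 0" "t > 0"
  shows "has_improper_integral (\<lambda>s. t / (a + s * t) - 1 / (1 + s)) (ln t - ln a)"
proof (rule has_improper_integralI[where F = "\<lambda>s. ln (a + s * t) - ln (1 + s)" and l = "ln t"])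
  fix s :: real assume s: "s \<ge> 0"
  then have "a + s * t > 0" "1 + s > 0" using assms by (auto intro: add_pos_nonneg)
  then show "((\<lambda>s. ln (a + s * t) - ln (1 + s)) has_real_derivative t / (a + s * t) - 1 / (1 + s)) (at s)"
    by (auto intro!: derivative_eq_intros)
next
  show "((\<lambda>s. ln (a + s * t) - ln (1 + s)) \<longlongrightarrow> ln t) at_top"
    using assms by real_asymp
qed simp

text \<open>The first divided difference of ln. It is the kernel, in an eigenbasis with eigenvalues a and b,
  of the Frechet derivative of the operator logarithm.\<close>
definition inv_log_mean :: "real \<Rightarrow> real \<Rightarrow> real"
  where "inv_log_mean a b = (if a = b then 1 / a else (ln a - ln b) / (a - b))"

lemma has_improper_integral_inv_log_mean:
  assumes "a > 0" "b > 0" "c > 0"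
  shows "has_improper_integral (\<lambda>s. (c / (a + s * c)) * (c / (b + s * c))) (c * inv_log_mean a b)"
proof (cases "a = b")
  case True
  show ?thesis
  proof (rule has_improper_integralI[where F = "\<lambda>s. - c / (a + s * c)" and l = 0])
    fix s :: real assume s: "s \<ge> 0"
    then have "a + s * c > 0" using assms by (auto intro: add_pos_nonneg)
    then show "((\<lambda>s. - c / (a + s * c)) has_real_derivative (c / (a + s * c)) * (c / (b + s * c))) (at s)"
      using True by (auto intro!: derivative_eq_intros simp: power2_eq_square)
  next
    show "((\<lambda>s. - c / (a + s * c)) \<longlongrightarrow> 0) at_top"
      using assms by real_asymp
  qed (use True assms in \<open>simp add: inv_log_mean_def\<close>)
next
  case False
  show ?thesis
  proof (rule has_improper_integralI
      [where F = "\<lambda>s. (c / (b - a)) * (ln (a + s * c) - ln (b + s * c))" and l = 0])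
    fix s :: real assume s: "s \<ge> 0"
    then have pos: "a + s * c > 0" "b + s * c > 0" using assms by (auto intro: add_pos_nonneg)
    have "(c / (b - a)) * (c / (a + s * c) - c / (b + s * c)) = (c / (a + s * c)) * (c / (b + s * c))"
      using pos False by (simp add: divide_simps) (simp add: algebra_simps)
    moreover have "((\<lambda>s. ln (a + s * c) - ln (b + s * c))
        has_real_derivative (c / (a + s * c) - c / (b + s * c))) (at s)"
      using pos by (auto intro!: derivative_eq_intros)
    note DERIV_cmult[OF this, of "c / (b - a)"]
    ultimately show "((\<lambda>s. (c / (b - a)) * (ln (a + s * c) - ln (b + s * c)))
        has_real_derivative (c / (a + s * c)) * (c / (b + s * c))) (at s)"
      by simp
  next
    have "((\<lambda>s. ln (a + s * c) - ln (b + s * c)) \<longlongrightarrow> 0) at_top"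
      using assms by real_asymp
    from tendsto_mult_left[OF this, of "c / (b - a)"]
    show "((\<lambda>s. (c / (b - a)) * (ln (a + s * c) - ln (b + s * c))) \<longlongrightarrow> 0) at_top"
      by simp
  next
    show "c * inv_log_mean a b = 0 - (c / (b - a)) * (ln (a + 0 * c) - ln (b + 0 * c))"
      using False by (simp add: inv_log_mean_def divide_simps) (simp add: algebra_simps)
  qed
qed

text \<open>The first divided difference of x |-> x ln x.\<close>
definition xlogx_slope :: "real \<Rightarrow> real \<Rightarrow> real"
  where "xlogx_slope c d = (if c = d then ln c + 1 else (c * ln c - d * ln d) / (c - d))"

text \<open>The point is that the value splits into a term in c and d alone and a term in b alone. In the
  sums below, orthonormality then removes the eigenbasis of b from the first term, and that of c and
  d from the second.\<close>
lemma has_improper_integral_xlogx_slope: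
  assumes "b > 0" "c > 0" "d > 0"
  shows "has_improper_integral
    (\<lambda>s. c / (b + s * c) + d / (b + s * d) - s * ((c / (b + s * c)) * (d / (b + s * d))) - 1 / (1 + s))
    (xlogx_slope c d - ln b)"
proof (cases "c = d")
  case True
  show ?thesis
  proof (rule has_improper_integralI
      [where F = "\<lambda>s. ln (b + s * c) - b / (b + s * c) - ln (1 + s)" and l = "ln c"])
    fix s :: real assume s: "s \<ge> 0"
    then have pos: "b + s * c > 0" "1 + s > 0" using assms by (auto intro: add_pos_nonneg)
    have eq: "c / (b + s * c) + d / (b + s * d) - s * ((c / (b + s * c)) * (d / (b + s * d)))
        = c / (b + s * c) + b * c / (b + s * c)\<^sup>2"
      using pos(1) True by (simp add: divide_simps power2_eq_square) (simp add: algebra_simps)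
    show "((\<lambda>s. ln (b + s * c) - b / (b + s * c) - ln (1 + s)) has_real_derivative
        c / (b + s * c) + d / (b + s * d) - s * ((c / (b + s * c)) * (d / (b + s * d))) - 1 / (1 + s)) (at s)"
      unfolding eq using pos by (auto intro!: derivative_eq_intros simp: power2_eq_square)
  next
    show "((\<lambda>s. ln (b + s * c) - b / (b + s * c) - ln (1 + s)) \<longlongrightarrow> ln c) at_top"
      using assms by real_asymp
  qed (use True assms in \<open>simp add: xlogx_slope_def\<close>)
next
  case False
  define k where "k = 1 / (c - d)"
  have k: "k * (c - d) = 1" using False by (simp add: k_def)
  show ?thesis
  proof (rule has_improper_integralI
      [where F = "\<lambda>s. (k * c) * ln (b + s * c) - (k * d) * ln (b + s * d) - ln (1 + s)"
        and l = "k * c * ln c - k * d * ln d"])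
    fix s :: real assume s: "s \<ge> 0"
    then have pos: "b + s * c > 0" "b + s * d > 0" "1 + s > 0" using assms by (auto intro: add_pos_nonneg)
    have eq: "c / (b + s * c) + d / (b + s * d) - s * ((c / (b + s * c)) * (d / (b + s * d)))
        = (k * c) * (c / (b + s * c)) - (k * d) * (d / (b + s * d))"
      unfolding k_def using pos(1,2) False by (simp add: divide_simps) (simp add: algebra_simps)
    show "((\<lambda>s. (k * c) * ln (b + s * c) - (k * d) * ln (b + s * d) - ln (1 + s)) has_real_derivative
        c / (b + s * c) + d / (b + s * d) - s * ((c / (b + s * c)) * (d / (b + s * d))) - 1 / (1 + s)) (at s)"
      unfolding eq using pos by (auto intro!: derivative_eq_intros simp: mult_ac)
  next
    have lim: "((\<lambda>s. ln (b + s * e) - ln (1 + s)) \<longlongrightarrow> ln e) at_top" if "e > 0" for e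
      using assms that by real_asymp
    have "((\<lambda>s. (k * c) * (ln (b + s * c) - ln (1 + s)) - (k * d) * (ln (b + s * d) - ln (1 + s)))
        \<longlongrightarrow> k * c * ln c - k * d * ln d) at_top"
      by (intro tendsto_diff tendsto_mult_left lim assms)
    also have "(\<lambda>s. (k * c) * (ln (b + s * c) - ln (1 + s)) - (k * d) * (ln (b + s * d) - ln (1 + s)))
        = (\<lambda>s. (k * c) * ln (b + s * c) - (k * d) * ln (b + s * d) - (k * (c - d)) * ln (1 + s))"
      by (simp add: algebra_simps)
    finally show "((\<lambda>s. (k * c) * ln (b + s * c) - (k * d) * ln (b + s * d) - ln (1 + s))
        \<longlongrightarrow> k * c * ln c - k * d * ln d) at_top"
      by (simp add: k)
  next
    have "k * c * ln b - k * d * ln b = (k * (c - d)) * ln b" by (simp add: algebra_simps)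
    then have "k * c * ln b - k * d * ln b = ln b" by (simp add: k)
    then show "xlogx_slope c d - ln b = k * c * ln c - k * d * ln d
        - ((k * c) * ln (b + 0 * c) - (k * d) * ln (b + 0 * d) - ln (1 + 0))"
      using False by (simp add: xlogx_slope_def k_def diff_divide_distrib)
  qed
qed

section \<open>The tangent plane inequality behind Lieb's theorem\<close>

lemma sum_square_expand:
  fixes f :: "'i \<Rightarrow> real"
  shows "(\<Sum>i\<in>A. f i)\<^sup>2 = (\<Sum>i\<in>A. \<Sum>j\<in>A. f i * f j)"
  by (simp add: power2_eq_square sum_product)

text \<open>The right-hand side is <T, (L_A + s R_T)^{-1} T> - tr T / (1 + s) for operators A and T with eigenbases P, Q and eigenvalues
  \<alpha>, \<tau>. The quadratic form is bounded below by 2 <K, T> - <K, (L_A + s R_T) K>, where K is the operator that maps x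
  to the sum over r and u of \<kappa> r u (r \<bullet> u) (u \<bullet> x) r. The inequality holds for every choice of
  coefficients \<kappa>. The left-hand side is this lower bound, less tr T / (1 + s), expanded in the bases R and U so
  that s and \<kappa> appear only in scalar factors that can be integrated one by one.\<close>
lemma lieb_integrand:
  fixes P Q R U :: "'a::euclidean_space set"
  assumes P: "orthonormal_basis P" and Q: "orthonormal_basis Q"
    and R: "orthonormal_basis R" and U: "orthonormal_basis U"
    and pos: "\<And>p. p \<in> P \<Longrightarrow> \<alpha> p > 0" "\<And>q. q \<in> Q \<Longrightarrow> \<tau> q > 0" and s: "s \<ge> (0::real)"
  shows "(\<Sum>q\<in>Q. \<tau> q * (\<Sum>r\<in>R. \<Sum>u\<in>U. \<Sum>v\<in>U. ((r \<bullet> u) * (u \<bullet> q) * ((r \<bullet> v) * (v \<bullet> q))) *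
            (\<kappa> r u + \<kappa> r v - s * (\<kappa> r u * \<kappa> r v) - 1 / (1 + s))))
       - (\<Sum>p\<in>P. \<alpha> p * (\<Sum>u\<in>U. \<Sum>r\<in>R. \<Sum>w\<in>R. ((r \<bullet> u) * (p \<bullet> r) * ((w \<bullet> u) * (p \<bullet> w))) *
            (\<kappa> r u * \<kappa> w u)))
     \<le> (\<Sum>p\<in>P. \<Sum>q\<in>Q. ((p \<bullet> q)\<^sup>2 * \<tau> q) * (\<tau> q / (\<alpha> p + s * \<tau> q) - 1 / (1 + s)))"
proof -
  define g where "g q r = (\<Sum>u\<in>U. \<kappa> r u * ((r \<bullet> u) * (u \<bullet> q)))" for q r
  define h where "h p u = (\<Sum>r\<in>R. \<kappa> r u * ((r \<bullet> u) * (p \<bullet> r)))" for p u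
  define K where "K q = (\<Sum>r\<in>R. g q r *\<^sub>R r)" for q
  define K' where "K' p = (\<Sum>u\<in>U. h p u *\<^sub>R u)" for p
  have K_inner: "p \<bullet> K q = K' p \<bullet> q" for p q
    unfolding K_def K'_def g_def h_def inner_sum_right inner_sum_left
    by (simp add: sum_distrib_right sum_distrib_left) (subst sum.swap, simp add: mult_ac)
  have inner_expand: "(\<Sum>b\<in>B. f b *\<^sub>R b) \<bullet> c = f c" if "orthonormal_basis B" "c \<in> B"
    for B :: "'a set" and f c
  proof -
    have "(\<Sum>b\<in>B. f b *\<^sub>R b) \<bullet> c = (\<Sum>b\<in>B. if b = c then f b else 0)"
      unfolding inner_sum_left using that
      by (intro sum.cong) (auto simp: orthonormal_basis_inner)
    then show ?thesis using that orthonormal_basis_finite[OF that(1)] by simp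
  qed
  have KK: "(\<Sum>p\<in>P. (p \<bullet> K q)\<^sup>2) = (\<Sum>r\<in>R. (g q r)\<^sup>2)" for q
  proof -
    have "(\<Sum>p\<in>P. (p \<bullet> K q)\<^sup>2) = K q \<bullet> K q"
      using orthonormal_basis_norm_squared[OF P, of "K q"] by (simp add: inner_commute)
    also have "\<dots> = (\<Sum>r\<in>R. (K q \<bullet> r)\<^sup>2)"
      using orthonormal_basis_norm_squared[OF R, of "K q"] by simp
    also have "\<dots> = (\<Sum>r\<in>R. (g q r)\<^sup>2)"
      by (intro sum.cong) (auto simp: K_def inner_expand[OF R])
    finally show ?thesis .
  qed
  have KK': "(\<Sum>q\<in>Q. (p \<bullet> K q)\<^sup>2) = (\<Sum>u\<in>U. (h p u)\<^sup>2)" for p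
  proof -
    have "(\<Sum>q\<in>Q. (p \<bullet> K q)\<^sup>2) = K' p \<bullet> K' p"
      using orthonormal_basis_norm_squared[OF Q, of "K' p"] by (simp add: K_inner)
    also have "\<dots> = (\<Sum>u\<in>U. (K' p \<bullet> u)\<^sup>2)"
      using orthonormal_basis_norm_squared[OF U, of "K' p"] by simp
    also have "\<dots> = (\<Sum>u\<in>U. (h p u)\<^sup>2)"
      by (intro sum.cong) (auto simp: K'_def inner_expand[OF U])
    finally show ?thesis .
  qed
  have PK: "(\<Sum>p\<in>P. (p \<bullet> q) * (p \<bullet> K q)) = (\<Sum>r\<in>R. (r \<bullet> q) * g q r)" for q
    using orthonormal_basis_parseval[OF P, of q "K q"]
    by (simp add: inner_commute) (simp add: K_def inner_sum_right inner_commute mult_ac)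
  have rq: "r \<bullet> q = (\<Sum>u\<in>U. (r \<bullet> u) * (u \<bullet> q))" for r q
    using orthonormal_basis_parseval[OF U, of r q] by (simp add: inner_commute)
  have first: "(\<Sum>r\<in>R. \<Sum>u\<in>U. \<Sum>v\<in>U. ((r \<bullet> u) * (u \<bullet> q) * ((r \<bullet> v) * (v \<bullet> q))) *
            (\<kappa> r u + \<kappa> r v - s * (\<kappa> r u * \<kappa> r v) - 1 / (1 + s)))
     = (\<Sum>p\<in>P. 2 * ((p \<bullet> q) * (p \<bullet> K q)) - s * (p \<bullet> K q)\<^sup>2 - (p \<bullet> q)\<^sup>2 / (1 + s))" for q
  proof -
    have "(\<Sum>u\<in>U. \<Sum>v\<in>U. ((r \<bullet> u) * (u \<bullet> q) * ((r \<bullet> v) * (v \<bullet> q))) *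
            (\<kappa> r u + \<kappa> r v - s * (\<kappa> r u * \<kappa> r v) - 1 / (1 + s)))
       = 2 * ((r \<bullet> q) * g q r) - s * (g q r)\<^sup>2 - (r \<bullet> q)\<^sup>2 / (1 + s)" for r
    proof -
      have "2 * ((r \<bullet> q) * g q r) = g q r * (r \<bullet> q) + (r \<bullet> q) * g q r" by simp
      also have "\<dots> = (\<Sum>u\<in>U. \<Sum>v\<in>U. ((r \<bullet> u) * (u \<bullet> q) * ((r \<bullet> v) * (v \<bullet> q))) * (\<kappa> r u + \<kappa> r v))"
        unfolding rq[of r q] g_def sum_product
        by (simp add: algebra_simps flip: sum.distrib)
      finally have 1: "2 * ((r \<bullet> q) * g q r) = \<dots>" .
      have 2: "s * (g q r)\<^sup>2 = (\<Sum>u\<in>U. \<Sum>v\<in>U. ((r \<bullet> u) * (u \<bullet> q) * ((r \<bullet> v) * (v \<bullet> q))) * (s * (\<kappa> r u * \<kappa> r v)))"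
        unfolding g_def sum_square_expand sum_distrib_left by (simp add: mult_ac)
      have 3: "(r \<bullet> q)\<^sup>2 / (1 + s) = (\<Sum>u\<in>U. \<Sum>v\<in>U. ((r \<bullet> u) * (u \<bullet> q) * ((r \<bullet> v) * (v \<bullet> q))) * (1 / (1 + s)))"
        unfolding rq[of r q] sum_square_expand sum_divide_distrib by simp
      show ?thesis
        unfolding 1 2 3 by (simp only: sum_subtractf[symmetric] right_diff_distrib)
    qed
    then have "(\<Sum>r\<in>R. \<Sum>u\<in>U. \<Sum>v\<in>U. ((r \<bullet> u) * (u \<bullet> q) * ((r \<bullet> v) * (v \<bullet> q))) *
            (\<kappa> r u + \<kappa> r v - s * (\<kappa> r u * \<kappa> r v) - 1 / (1 + s)))
       = 2 * (\<Sum>r\<in>R. (r \<bullet> q) * g q r) - s * (\<Sum>r\<in>R. (g q r)\<^sup>2) - (\<Sum>r\<in>R. (r \<bullet> q)\<^sup>2) / (1 + s)"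
      by (simp add: sum_subtractf sum_distrib_left sum_divide_distrib)
    also have "(\<Sum>r\<in>R. (r \<bullet> q)\<^sup>2) = (\<Sum>p\<in>P. (p \<bullet> q)\<^sup>2)"
      using orthonormal_basis_norm_squared[OF P, of q] orthonormal_basis_norm_squared[OF R, of q]
      by (simp add: inner_commute)
    finally show ?thesis
      unfolding KK[symmetric] PK[symmetric]
      by (simp add: sum_subtractf sum_distrib_left sum_divide_distrib)
  qed
  have second: "(\<Sum>u\<in>U. \<Sum>r\<in>R. \<Sum>w\<in>R. ((r \<bullet> u) * (p \<bullet> r) * ((w \<bullet> u) * (p \<bullet> w))) * (\<kappa> r u * \<kappa> w u))
     = (\<Sum>q\<in>Q. (p \<bullet> K q)\<^sup>2)" for p
    unfolding KK' h_def sum_square_expand by (simp add: mult_ac)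
  have swap: "(\<Sum>p\<in>P. \<Sum>q\<in>Q. a p q - b p q) = (\<Sum>q\<in>Q. \<Sum>p\<in>P. a p q) - (\<Sum>p\<in>P. \<Sum>q\<in>Q. b p q)"
    for a b :: "'a \<Rightarrow> 'a \<Rightarrow> real"
    by (simp add: sum_subtractf) (rule sum.swap)
  (* Completing the square in the (p, q) entry of K. *)
  have "\<tau> q * (2 * ((p \<bullet> q) * (p \<bullet> K q)) - s * (p \<bullet> K q)\<^sup>2 - (p \<bullet> q)\<^sup>2 / (1 + s)) - \<alpha> p * (p \<bullet> K q)\<^sup>2
      \<le> ((p \<bullet> q)\<^sup>2 * \<tau> q) * (\<tau> q / (\<alpha> p + s * \<tau> q) - 1 / (1 + s))"
    if "p \<in> P" "q \<in> Q" for p q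
  proof -
    define w where "w = \<alpha> p + s * \<tau> q"
    have w: "w > 0" using pos(1)[OF that(1)] pos(2)[OF that(2)] s by (simp add: w_def add_pos_nonneg)
    define x k where "x = \<tau> q * (p \<bullet> q)" and "k = p \<bullet> K q"
    have "0 \<le> w * (k - x / w)\<^sup>2" using w by simp
    also have "\<dots> = w * k\<^sup>2 - 2 * (x * k) + x\<^sup>2 / w"
      using w by (simp add: power2_eq_square algebra_simps)
    finally have "2 * (x * k) - w * k\<^sup>2 \<le> x\<^sup>2 / w" by simp
    then show ?thesis
      by (simp add: x_def k_def w_def power2_eq_square algebra_simps)
  qed
  then have "(\<Sum>p\<in>P. \<Sum>q\<in>Q. \<tau> q * (2 * ((p \<bullet> q) * (p \<bullet> K q)) - s * (p \<bullet> K q)\<^sup>2 - (p \<bullet> q)\<^sup>2 / (1 + s))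
        - \<alpha> p * (p \<bullet> K q)\<^sup>2)
      \<le> (\<Sum>p\<in>P. \<Sum>q\<in>Q. ((p \<bullet> q)\<^sup>2 * \<tau> q) * (\<tau> q / (\<alpha> p + s * \<tau> q) - 1 / (1 + s)))"
    by (intro sum_mono)
  also have "(\<Sum>p\<in>P. \<Sum>q\<in>Q. \<tau> q * (2 * ((p \<bullet> q) * (p \<bullet> K q)) - s * (p \<bullet> K q)\<^sup>2 - (p \<bullet> q)\<^sup>2 / (1 + s))
        - \<alpha> p * (p \<bullet> K q)\<^sup>2)
     = (\<Sum>q\<in>Q. \<tau> q * (\<Sum>p\<in>P. 2 * ((p \<bullet> q) * (p \<bullet> K q)) - s * (p \<bullet> K q)\<^sup>2 - (p \<bullet> q)\<^sup>2 / (1 + s)))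
      - (\<Sum>p\<in>P. \<alpha> p * (\<Sum>q\<in>Q. (p \<bullet> K q)\<^sup>2))"
    unfolding sum_distrib_left by (rule swap)
  finally show ?thesis unfolding first second .
qed

text \<open>The operator G of the introduction is the Frechet derivative of the operator logarithm at exp W,
  applied to exp(H + W). It is given here by an orthonormal eigenbasis B and its eigenvalues \<gamma>, so
  that tr(G exp X) is a nonnegative combination of the numbers b \<bullet> exp(X) b.

  With A = exp X and T = exp(H + X), the quantity tr T (log T - log A) is tr T H. The
  linear lower bound obtained from the reference pair (exp W, exp(H + W)) evaluates
  to tr T H + tr T - tr G A. Comparing the two leaves tr T <= tr G A.\<close>
theorem trace_exp_tangent:
  fixes H W :: "'a::euclidean_space \<Rightarrow> 'a"
  assumes H: "self_adjoint H" and W: "self_adjoint W"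
  obtains B \<gamma> where "finite B" "\<And>b. b \<in> B \<Longrightarrow> (0::real) \<le> \<gamma> b"
    "\<And>X. self_adjoint X \<Longrightarrow>
       op_trace (op_exp (\<lambda>x. H x + X x)) \<le> (\<Sum>b\<in>B. \<gamma> b * (b \<bullet> op_exp X b))"
    "op_trace (op_exp (\<lambda>x. H x + W x)) = (\<Sum>b\<in>B. \<gamma> b * (b \<bullet> op_exp W b))"
proof -
  let ?HW = "\<lambda>x. H x + W x"
  have HW: "self_adjoint ?HW" by (rule self_adjoint_add[OF H W])
  obtain R where R: "eigenbasis W R" by (rule eigenbasis_exists[OF W])
  obtain U where U: "eigenbasis ?HW U" by (rule eigenbasis_exists[OF HW])
  note R' = eigenbasisD(1)[OF R] and U' = eigenbasisD(1)[OF U]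
  define \<beta> where "\<beta> r = exp (r \<bullet> W r)" for r
  define c where "c u = exp (u \<bullet> ?HW u)" for u
  have pos: "\<beta> r > 0" "c u > 0" for r u by (simp_all add: \<beta>_def c_def)
  (* These coefficients solve B K + s K C = C, with B = exp W and C = exp (H + W). The resulting K
     maximizes the linear lower bound at the reference pair, so the bound is tight for X = W. *)
  define \<kappa> where "\<kappa> s r u = c u / (\<beta> r + s * c u)" for s r u
  define G where "G x = (\<Sum>u\<in>U. \<Sum>r\<in>R. \<Sum>w\<in>R.
      (c u * inv_log_mean (\<beta> r) (\<beta> w) * ((r \<bullet> u) * (w \<bullet> u)) * (x \<bullet> r)) *\<^sub>R w)" for x
  have ilm_comm: "inv_log_mean a b = inv_log_mean b a" for a b
    by (auto simp: inv_log_mean_def divide_simps) (simp add: algebra_simps)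
  have G: "self_adjoint G"
    unfolding self_adjoint_def
  proof safe
    show "linear G"
      by (rule linearI) (simp_all add: G_def inner_add_left algebra_simps sum.distrib scaleR_sum_right)
  next
    fix x y
    have "G x \<bullet> y = y \<bullet> G x" by (rule inner_commute)
    also have "\<dots> = (\<Sum>u\<in>U. \<Sum>r\<in>R. \<Sum>w\<in>R.
        c u * inv_log_mean (\<beta> r) (\<beta> w) * ((r \<bullet> u) * (w \<bullet> u)) * ((x \<bullet> r) * (y \<bullet> w)))"
      by (simp add: G_def inner_sum_right mult_ac)
    also have "\<dots> = (\<Sum>u\<in>U. \<Sum>r\<in>R. \<Sum>w\<in>R.
        c u * inv_log_mean (\<beta> r) (\<beta> w) * ((r \<bullet> u) * (w \<bullet> u)) * ((y \<bullet> r) * (x \<bullet> w)))"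
      by (rule sum.cong[OF refl], subst sum.swap) (simp add: ilm_comm mult_ac)
    also have "\<dots> = x \<bullet> G y"
      by (simp add: G_def inner_sum_right mult_ac)
    finally show "G x \<bullet> y = x \<bullet> G y" .
  qed
  have G_quad: "x \<bullet> G x = (\<Sum>u\<in>U. \<Sum>r\<in>R. \<Sum>w\<in>R.
      ((r \<bullet> u) * (x \<bullet> r) * ((w \<bullet> u) * (x \<bullet> w))) * (c u * inv_log_mean (\<beta> r) (\<beta> w)))" for x
    by (simp add: G_def inner_sum_right mult_ac)
  have G_integral: "has_improper_integral
      (\<lambda>s. \<Sum>u\<in>U. \<Sum>r\<in>R. \<Sum>w\<in>R.
          ((r \<bullet> u) * (x \<bullet> r) * ((w \<bullet> u) * (x \<bullet> w))) * (\<kappa> s r u * \<kappa> s w u)) (x \<bullet> G x)" for x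
    unfolding G_quad \<kappa>_def
    by (intro has_improper_integral_sum has_improper_integral_cmult
        has_improper_integral_inv_log_mean pos)
  have G_nonneg: "0 \<le> x \<bullet> G x" for x
  proof (rule has_improper_integral_nonneg[OF G_integral])
    fix s :: real
    have "(\<Sum>u\<in>U. \<Sum>r\<in>R. \<Sum>w\<in>R.
          ((r \<bullet> u) * (x \<bullet> r) * ((w \<bullet> u) * (x \<bullet> w))) * (\<kappa> s r u * \<kappa> s w u))
        = (\<Sum>u\<in>U. (\<Sum>r\<in>R. (r \<bullet> u) * (x \<bullet> r) * \<kappa> s r u)\<^sup>2)"
      unfolding sum_square_expand by (simp add: mult_ac)
    then show "0 \<le> (\<Sum>u\<in>U. \<Sum>r\<in>R. \<Sum>w\<in>R.
          ((r \<bullet> u) * (x \<bullet> r) * ((w \<bullet> u) * (x \<bullet> w))) * (\<kappa> s r u * \<kappa> s w u))"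
      by (simp add: sum_nonneg)
  qed
  obtain B where B: "eigenbasis G B" by (rule eigenbasis_exists[OF G])
  have pairing: "(\<Sum>b\<in>B. (b \<bullet> G b) * (b \<bullet> op_exp X b)) = (\<Sum>p\<in>P. exp (p \<bullet> X p) * (p \<bullet> G p))"
    if X: "self_adjoint X" and P: "eigenbasis X P" for X P
  proof -
    have "(\<Sum>b\<in>B. (b \<bullet> G b) * (b \<bullet> op_exp X b))
        = (\<Sum>b\<in>B. \<Sum>p\<in>P. exp (p \<bullet> X p) * ((b \<bullet> G b) * (p \<bullet> b)\<^sup>2))"
      by (simp add: inner_op_exp[OF P self_adjointD(1)[OF X]] sum_distrib_left inner_commute mult_ac)
    also have "\<dots> = (\<Sum>p\<in>P. exp (p \<bullet> X p) * (p \<bullet> G p))"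
      by (subst sum.swap)
        (simp add: inner_self_adjoint[OF B self_adjointD(1)[OF G], symmetric] flip: sum_distrib_left)
    finally show ?thesis .
  qed
  have equality: "op_trace (op_exp ?HW) = (\<Sum>b\<in>B. (b \<bullet> G b) * (b \<bullet> op_exp W b))"
  proof -
    have "\<beta> r * (r \<bullet> G r) = (\<Sum>u\<in>U. c u * (r \<bullet> u)\<^sup>2)" if r: "r \<in> R" for r
    proof -
      have inner_r: "r \<bullet> r' = (if r = r' then 1 else 0)" if "r' \<in> R" for r'
        using orthonormal_basis_inner[OF R' r that] .
      have "r \<bullet> G r = (\<Sum>u\<in>U. \<Sum>r'\<in>R. if r = r' then (\<Sum>w\<in>R. if r = w then
          (r \<bullet> u)\<^sup>2 * (c u * inv_log_mean (\<beta> r) (\<beta> r)) else 0) else 0)"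
        unfolding G_quad by (intro sum.cong refl)
          (auto simp: inner_r power2_eq_square intro!: sum.cong)
      also have "\<dots> = (\<Sum>u\<in>U. (r \<bullet> u)\<^sup>2 * (c u / \<beta> r))"
        using r eigenbasisD(2)[OF R] by (simp add: inv_log_mean_def)
      finally show ?thesis
        using pos(1)[of r] by (simp add: sum_distrib_left mult_ac)
    qed
    then have "(\<Sum>b\<in>B. (b \<bullet> G b) * (b \<bullet> op_exp W b)) = (\<Sum>r\<in>R. \<Sum>u\<in>U. c u * (r \<bullet> u)\<^sup>2)"
      unfolding pairing[OF W R] \<beta>_def by (intro sum.cong) auto
    also have "\<dots> = (\<Sum>u\<in>U. c u * (\<Sum>r\<in>R. (u \<bullet> r)\<^sup>2))"
      by (subst sum.swap) (simp add: sum_distrib_left inner_commute)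
    also have "\<dots> = (\<Sum>u\<in>U. c u)"
      by (intro sum.cong refl)
        (simp add: orthonormal_basis_norm_squared[OF R'] orthonormal_basis_inner[OF U'])
    finally show ?thesis
      by (simp add: op_trace_op_exp[OF U HW] c_def)
  qed
  have le: "op_trace (op_exp (\<lambda>x. H x + X x)) \<le> (\<Sum>b\<in>B. (b \<bullet> G b) * (b \<bullet> op_exp X b))"
    if X: "self_adjoint X" for X
  proof -
    let ?HX = "\<lambda>x. H x + X x"
    have HX: "self_adjoint ?HX" by (rule self_adjoint_add[OF H X])
    obtain P where P: "eigenbasis X P" by (rule eigenbasis_exists[OF X])
    obtain Q where Q: "eigenbasis ?HX Q" by (rule eigenbasis_exists[OF HX])
    define \<alpha> where "\<alpha> p = exp (p \<bullet> X p)" for p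
    define \<tau> where "\<tau> q = exp (q \<bullet> ?HX q)" for q
    have pos': "\<alpha> p > 0" "\<tau> q > 0" for p q by (simp_all add: \<alpha>_def \<tau>_def)
    define E where "E q = (\<Sum>r\<in>R. \<Sum>u\<in>U. \<Sum>v\<in>U. ((r \<bullet> u) * (u \<bullet> q) * ((r \<bullet> v) * (v \<bullet> q))) *
        (xlogx_slope (c u) (c v) - ln (\<beta> r)))" for q
    have "(\<Sum>q\<in>Q. \<tau> q * E q) - (\<Sum>p\<in>P. \<alpha> p * (p \<bullet> G p))
        \<le> (\<Sum>p\<in>P. \<Sum>q\<in>Q. ((p \<bullet> q)\<^sup>2 * \<tau> q) * (ln (\<tau> q) - ln (\<alpha> p)))"
      (is "?I \<le> ?J")
    proof (rule has_improper_integral_le)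
      show "has_improper_integral (\<lambda>s.
          (\<Sum>q\<in>Q. \<tau> q * (\<Sum>r\<in>R. \<Sum>u\<in>U. \<Sum>v\<in>U. ((r \<bullet> u) * (u \<bullet> q) * ((r \<bullet> v) * (v \<bullet> q))) *
            (\<kappa> s r u + \<kappa> s r v - s * (\<kappa> s r u * \<kappa> s r v) - 1 / (1 + s))))
          - (\<Sum>p\<in>P. \<alpha> p * (\<Sum>u\<in>U. \<Sum>r\<in>R. \<Sum>w\<in>R. ((r \<bullet> u) * (p \<bullet> r) * ((w \<bullet> u) * (p \<bullet> w))) *
            (\<kappa> s r u * \<kappa> s w u)))) ?I"
        unfolding E_def \<kappa>_def
        by (intro has_improper_integral_diff has_improper_integral_sum has_improper_integral_cmult
            has_improper_integral_xlogx_slope pos G_integral[unfolded \<kappa>_def])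
      show "has_improper_integral (\<lambda>s. \<Sum>p\<in>P. \<Sum>q\<in>Q.
          ((p \<bullet> q)\<^sup>2 * \<tau> q) * (\<tau> q / (\<alpha> p + s * \<tau> q) - 1 / (1 + s))) ?J"
        by (intro has_improper_integral_sum has_improper_integral_cmult has_improper_integral_ln pos')
    qed (rule lieb_integrand[OF eigenbasisD(1)[OF P] eigenbasisD(1)[OF Q] R' U' pos'])
    also have "?J = (\<Sum>q\<in>Q. \<tau> q * (q \<bullet> H q))"
    proof -
      have "?J = (\<Sum>q\<in>Q. \<tau> q * (ln (\<tau> q) * (\<Sum>p\<in>P. (q \<bullet> p)\<^sup>2)
          - (\<Sum>p\<in>P. (p \<bullet> X p) * (q \<bullet> p)\<^sup>2)))"
        by (subst sum.swap)
          (simp add: \<alpha>_def sum_distrib_left inner_commute algebra_simps flip: sum_subtractf)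
      also have "\<dots> = (\<Sum>q\<in>Q. \<tau> q * (q \<bullet> H q))"
        by (intro sum.cong refl)
          (simp add: orthonormal_basis_norm_squared[OF eigenbasisD(1)[OF P]]
            orthonormal_basis_inner[OF eigenbasisD(1)[OF Q]] \<tau>_def inner_add_right
            flip: inner_self_adjoint[OF P self_adjointD(1)[OF X]])
      finally show ?thesis .
    qed
    also have "(\<Sum>q\<in>Q. \<tau> q * E q) = (\<Sum>q\<in>Q. \<tau> q * (q \<bullet> H q) + \<tau> q)"
    proof (rule sum.cong[OF refl])
      fix q assume q: "q \<in> Q"
      have qq: "q \<bullet> q = 1" using orthonormal_basis_inner[OF eigenbasisD(1)[OF Q] q q] by simp
      have uv: "(\<Sum>r\<in>R. (r \<bullet> u) * (r \<bullet> v)) = (if u = v then 1 else 0)" if "u \<in> U" "v \<in> U" for u v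
        using orthonormal_basis_parseval[OF R', of u v] orthonormal_basis_inner[OF U' that]
        by (simp add: inner_commute)
      have qr: "(\<Sum>u\<in>U. \<Sum>v\<in>U. (r \<bullet> u) * (u \<bullet> q) * ((r \<bullet> v) * (v \<bullet> q))) = (q \<bullet> r)\<^sup>2" for r
      proof -
        have "(q \<bullet> r)\<^sup>2 = (\<Sum>u\<in>U. (r \<bullet> u) * (u \<bullet> q))\<^sup>2"
          using orthonormal_basis_parseval[OF U', of r q] by (simp add: inner_commute)
        then show ?thesis by (simp add: sum_square_expand)
      qed
      have "(\<Sum>r\<in>R. \<Sum>u\<in>U. \<Sum>v\<in>U. ((r \<bullet> u) * (u \<bullet> q) * ((r \<bullet> v) * (v \<bullet> q))) * xlogx_slope (c u) (c v))
          = (\<Sum>u\<in>U. \<Sum>v\<in>U. \<Sum>r\<in>R. ((r \<bullet> u) * (u \<bullet> q) * ((r \<bullet> v) * (v \<bullet> q))) * xlogx_slope (c u) (c v))"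
        by (subst sum.swap, rule sum.cong[OF refl], rule sum.swap)
      also have "\<dots> = (\<Sum>u\<in>U. \<Sum>v\<in>U. ((u \<bullet> q) * (v \<bullet> q) * xlogx_slope (c u) (c v))
          * (\<Sum>r\<in>R. (r \<bullet> u) * (r \<bullet> v)))"
        by (simp add: sum_distrib_left mult_ac)
      also have "\<dots> = (\<Sum>u\<in>U. \<Sum>v\<in>U. if u = v then (u \<bullet> q)\<^sup>2 * (ln (c u) + 1) else 0)"
        by (intro sum.cong refl) (auto simp: uv power2_eq_square xlogx_slope_def)
      also have "\<dots> = (\<Sum>u\<in>U. (u \<bullet> ?HW u) * (q \<bullet> u)\<^sup>2) + (\<Sum>u\<in>U. (q \<bullet> u)\<^sup>2)"
        using eigenbasisD(2)[OF U]
        by (simp add: c_def sum.distrib[symmetric] algebra_simps inner_commute)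
      also have "\<dots> = q \<bullet> ?HW q + 1"
        by (simp add: inner_self_adjoint[OF U self_adjointD(1)[OF HW], symmetric]
            orthonormal_basis_norm_squared[OF U'] qq)
      finally have 1: "(\<Sum>r\<in>R. \<Sum>u\<in>U. \<Sum>v\<in>U. ((r \<bullet> u) * (u \<bullet> q) * ((r \<bullet> v) * (v \<bullet> q)))
          * xlogx_slope (c u) (c v)) = q \<bullet> ?HW q + 1" .
      have "(\<Sum>r\<in>R. \<Sum>u\<in>U. \<Sum>v\<in>U. ((r \<bullet> u) * (u \<bullet> q) * ((r \<bullet> v) * (v \<bullet> q))) * ln (\<beta> r))
          = (\<Sum>r\<in>R. (r \<bullet> W r) * (q \<bullet> r)\<^sup>2)"
        unfolding qr[symmetric] by (simp add: \<beta>_def sum_distrib_left mult_ac)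
      also have "\<dots> = q \<bullet> W q"
        by (rule inner_self_adjoint[OF R self_adjointD(1)[OF W], symmetric])
      finally have 2: "(\<Sum>r\<in>R. \<Sum>u\<in>U. \<Sum>v\<in>U. ((r \<bullet> u) * (u \<bullet> q) * ((r \<bullet> v) * (v \<bullet> q)))
          * ln (\<beta> r)) = q \<bullet> W q" .
      have "E q = q \<bullet> H q + 1"
        unfolding E_def right_diff_distrib sum_subtractf 1 2 by (simp add: inner_add_right)
      then show "\<tau> q * E q = \<tau> q * (q \<bullet> H q) + \<tau> q" by (simp add: algebra_simps)
    qed
    finally have "(\<Sum>q\<in>Q. \<tau> q) \<le> (\<Sum>p\<in>P. \<alpha> p * (p \<bullet> G p))"
      by (simp add: sum.distrib)
    then show ?thesis
      unfolding pairing[OF X P] by (simp add: op_trace_op_exp[OF Q HX] \<tau>_def \<alpha>_def)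
  qed
  show thesis
    using eigenbasisD(2)[OF B] G_nonneg le equality
    by (intro that[of B "\<lambda>b. b \<bullet> G b"])
qed

section \<open>Trace exponentials of sums of independent operators\<close>

lemma inner_op_exp_nonneg:
  fixes A :: "'a::euclidean_space \<Rightarrow> 'a"
  assumes "self_adjoint A"
  shows "0 \<le> x \<bullet> op_exp A x"
proof -
  obtain B where "eigenbasis A B" by (rule eigenbasis_exists[OF assms])
  from inner_op_exp[OF this self_adjointD(1)[OF assms]] show ?thesis
    by (simp add: sum_nonneg)
qed

lemma op_trace_op_exp_nonneg:
  "self_adjoint A \<Longrightarrow> 0 \<le> op_trace (op_exp A)"
  unfolding op_trace_def by (intro sum_nonneg inner_op_exp_nonneg)

lemma borel_measurable_op_exp:
  fixes f :: "'c::euclidean_space \<Rightarrow> 'a::euclidean_space \<Rightarrow> 'a"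
  assumes cont: "continuous_on UNIV (\<lambda>(s, x). f s x)" and sa: "\<And>s. self_adjoint (f s)"
  shows "(\<lambda>s. op_exp (f s) x) \<in> borel_measurable borel"
proof (rule borel_measurable_LIMSEQ_metric)
  show "(\<lambda>n. \<Sum>k<n. (f s ^^ k) x /\<^sub>R fact k) \<longlonglongrightarrow> op_exp (f s) x" for s
  proof -
    obtain B where B: "eigenbasis (f s) B" by (rule eigenbasis_exists[OF sa])
    show ?thesis
      using op_exp_sums_eigenbasis[OF B self_adjointD(1)[OF sa]]
        op_exp_eigenbasis[OF B self_adjointD(1)[OF sa]]
      by (simp add: sums_def)
  qed
  have "continuous_on UNIV (\<lambda>s. (f s ^^ k) x)" for k
  proof (induction k)
    case (Suc k)
    have "continuous_on UNIV (\<lambda>s. (\<lambda>(s, x). f s x) (s, (f s ^^ k) x))"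
      by (rule continuous_on_compose2[OF cont]) (auto intro!: continuous_intros Suc)
    then show ?case by simp
  qed simp
  then show "(\<lambda>s. \<Sum>k<n. (f s ^^ k) x /\<^sub>R fact k) \<in> borel_measurable borel" for n
    by (intro borel_measurable_continuous_onI continuous_intros)
qed

text \<open>The tangent plane inequality is linear in exp X, and the weights \<gamma> are nonnegative, so the
  hypothesis on the quadratic forms of E exp X can be inserted term by term.\<close>
lemma trace_exp_expectation_le:
  fixes H W :: "'a::euclidean_space \<Rightarrow> 'a" and X :: "'b \<Rightarrow> 'a \<Rightarrow> 'a"
  assumes H: "self_adjoint H" and W: "self_adjoint W" and X: "\<And>\<omega>. self_adjoint (X \<omega>)"
    and meas: "\<And>x. (\<lambda>\<omega>. x \<bullet> op_exp (X \<omega>) x) \<in> borel_measurable M"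
    and mgf: "\<And>x. (\<integral>\<^sup>+\<omega>. ennreal (x \<bullet> op_exp (X \<omega>) x) \<partial>M) \<le> ennreal (x \<bullet> op_exp W x)"
  shows "(\<integral>\<^sup>+\<omega>. ennreal (op_trace (op_exp (\<lambda>x. H x + X \<omega> x))) \<partial>M)
    \<le> ennreal (op_trace (op_exp (\<lambda>x. H x + W x)))"
proof -
  obtain B \<gamma> where B: "finite B" "\<And>b. b \<in> B \<Longrightarrow> (0::real) \<le> \<gamma> b"
    "\<And>X. self_adjoint X \<Longrightarrow>
       op_trace (op_exp (\<lambda>x. H x + X x)) \<le> (\<Sum>b\<in>B. \<gamma> b * (b \<bullet> op_exp X b))"
    "op_trace (op_exp (\<lambda>x. H x + W x)) = (\<Sum>b\<in>B. \<gamma> b * (b \<bullet> op_exp W b))"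
    by (rule trace_exp_tangent[OF H W]) (rule that)
  have "(\<integral>\<^sup>+\<omega>. ennreal (op_trace (op_exp (\<lambda>x. H x + X \<omega> x))) \<partial>M)
      \<le> (\<integral>\<^sup>+\<omega>. (\<Sum>b\<in>B. ennreal (\<gamma> b) * ennreal (b \<bullet> op_exp (X \<omega>) b)) \<partial>M)"
  proof (rule nn_integral_mono)
    fix \<omega>
    have "(\<Sum>b\<in>B. ennreal (\<gamma> b) * ennreal (b \<bullet> op_exp (X \<omega>) b))
        = ennreal (\<Sum>b\<in>B. \<gamma> b * (b \<bullet> op_exp (X \<omega>) b))"
      using B(2) X by (simp add: inner_op_exp_nonneg flip: ennreal_mult)
    then show "ennreal (op_trace (op_exp (\<lambda>x. H x + X \<omega> x)))
        \<le> (\<Sum>b\<in>B. ennreal (\<gamma> b) * ennreal (b \<bullet> op_exp (X \<omega>) b))"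
      using B(3)[OF X] by (simp add: ennreal_leI)
  qed
  also have "\<dots> = (\<Sum>b\<in>B. ennreal (\<gamma> b) * (\<integral>\<^sup>+\<omega>. ennreal (b \<bullet> op_exp (X \<omega>) b) \<partial>M))"
    using meas by (simp add: nn_integral_sum nn_integral_cmult)
  also have "\<dots> \<le> (\<Sum>b\<in>B. ennreal (\<gamma> b) * ennreal (b \<bullet> op_exp W b))"
    by (intro sum_mono mult_left_mono mgf) auto
  also have "\<dots> = ennreal (\<Sum>b\<in>B. \<gamma> b * (b \<bullet> op_exp W b))"
    using B(2) W by (simp add: inner_op_exp_nonneg flip: ennreal_mult)
  finally show ?thesis by (simp add: B(4))
qed

context prob_space
begin

lemma indep_var_sum:
  fixes X :: "'i \<Rightarrow> 'a \<Rightarrow> 'b::euclidean_space"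
  assumes I: "finite I" "i \<notin> I" and indep: "indep_vars (\<lambda>_. borel) X (insert i I)"
  shows "indep_var borel (X i) borel (\<lambda>\<omega>. \<Sum>i\<in>I. X i \<omega>)"
proof -
  have "indep_var
    borel ((\<lambda>f. f i) \<circ> (\<lambda>\<omega>. restrict (\<lambda>i. X i \<omega>) {i}))
    borel ((\<lambda>f. \<Sum>i\<in>I. f i) \<circ> (\<lambda>\<omega>. restrict (\<lambda>i. X i \<omega>) I))"
    using I by (intro indep_var_compose[OF indep_var_restrict[OF indep]]) auto
  also have "((\<lambda>f. f i) \<circ> (\<lambda>\<omega>. restrict (\<lambda>i. X i \<omega>) {i})) = X i"
    by auto
  also have "((\<lambda>f. \<Sum>i\<in>I. f i) \<circ> (\<lambda>\<omega>. restrict (\<lambda>i. X i \<omega>) I)) = (\<lambda>\<omega>. \<Sum>i\<in>I. X i \<omega>)"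
    by (auto cong: rev_conj_cong)
  finally show ?thesis .
qed

text \<open>The integral over Y is the outer one because, in the induction below, the moment bound for a
  single summand X is applied with the value of the remaining sum Y fixed.\<close>
lemma nn_integral_indep_var:
  fixes X Y :: "'a \<Rightarrow> 'b::euclidean_space"
  assumes ind: "indep_var borel X borel Y" and f: "case_prod f \<in> borel_measurable (borel \<Otimes>\<^sub>M borel)"
  shows "(\<integral>\<^sup>+\<omega>. f (X \<omega>) (Y \<omega>) \<partial>M) = (\<integral>\<^sup>+\<omega>'. (\<integral>\<^sup>+\<omega>. f (X \<omega>) (Y \<omega>') \<partial>M) \<partial>M)"
proof -
  have X: "X \<in> borel_measurable M" and Y: "Y \<in> borel_measurable M"
    and eq: "distr M borel X \<Otimes>\<^sub>M distr M borel Y = distr M (borel \<Otimes>\<^sub>M borel) (\<lambda>x. (X x, Y x))"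
    using ind by (auto simp: indep_var_distribution_eq)
  interpret X: prob_space "distr M borel X" by (rule prob_space_distr) fact
  interpret Y: prob_space "distr M borel Y" by (rule prob_space_distr) fact
  interpret XY: pair_sigma_finite "distr M borel X" "distr M borel Y" ..
  have f': "case_prod f \<in> borel_measurable (distr M borel X \<Otimes>\<^sub>M distr M borel Y)"
    using f by (simp add: measurable_cong_sets[OF sets_pair_measure_cong[OF sets_distr sets_distr] refl])
  have slice: "(\<lambda>x. f x y) \<in> borel_measurable borel" for y
    using measurable_compose[OF measurable_Pair2'[of y borel borel] f] by simp
  have slices: "(\<lambda>y. \<integral>\<^sup>+x. f x y \<partial>distr M borel X) \<in> borel_measurable borel"
    using X.borel_measurable_nn_integral[of "\<lambda>y x. f x y" borel]
      measurable_compose[OF measurable_pair_swap' f]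
    by (simp add: case_prod_beta measurable_cong_sets[OF sets_pair_measure_cong[OF refl sets_distr] refl])
  have "(\<integral>\<^sup>+\<omega>. f (X \<omega>) (Y \<omega>) \<partial>M) = (\<integral>\<^sup>+\<omega>. case_prod f (X \<omega>, Y \<omega>) \<partial>M)"
    by simp
  also have "\<dots> = (\<integral>\<^sup>+z. case_prod f z \<partial>distr M (borel \<Otimes>\<^sub>M borel) (\<lambda>x. (X x, Y x)))"
    by (rule nn_integral_distr[symmetric]) (auto intro!: f X Y measurable_Pair)
  also have "\<dots> = (\<integral>\<^sup>+z. case_prod f z \<partial>(distr M borel X \<Otimes>\<^sub>M distr M borel Y))"
    by (simp only: eq)
  also have "\<dots> = (\<integral>\<^sup>+y. (\<integral>\<^sup>+x. f x y \<partial>distr M borel X) \<partial>distr M borel Y)"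
    using XY.nn_integral_snd[OF f'] by simp
  also have "\<dots> = (\<integral>\<^sup>+\<omega>'. (\<integral>\<^sup>+x. f x (Y \<omega>') \<partial>distr M borel X) \<partial>M)"
    by (rule nn_integral_distr[OF Y], unfold measurable_distr_eq1, rule slices)
  also have "\<dots> = (\<integral>\<^sup>+\<omega>'. (\<integral>\<^sup>+\<omega>. f (X \<omega>) (Y \<omega>') \<partial>M) \<partial>M)"
    by (rule nn_integral_cong, rule nn_integral_distr[OF X], unfold measurable_distr_eq1, rule slice)
  finally show ?thesis .
qed

text \<open>The summands are replaced by their deterministic bounds W k one at a time: for a fixed value of
  the other summands, these join H in the fixed part of the exponent. The general H is what
  makes the induction go through, since each finished W k is added to it.\<close>
theorem trace_mgf_sum_le:
  fixes D :: "'c::euclidean_space \<Rightarrow> 'e::euclidean_space \<Rightarrow> 'e" and S :: "'i \<Rightarrow> 'a \<Rightarrow> 'c"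
  assumes D: "bounded_bilinear D" and Dsa: "\<And>s. self_adjoint (D s)"
    and I: "finite I" and indep: "indep_vars (\<lambda>_. borel) S I"
    and W: "\<And>k. k \<in> I \<Longrightarrow> self_adjoint (W k)"
    and mgf: "\<And>k x. k \<in> I \<Longrightarrow>
      (\<integral>\<^sup>+\<omega>. ennreal (x \<bullet> op_exp (D (S k \<omega>)) x) \<partial>M) \<le> ennreal (x \<bullet> op_exp (W k) x)"
    and H: "self_adjoint H"
  shows "(\<integral>\<^sup>+\<omega>. ennreal (op_trace (op_exp (\<lambda>x. H x + D (\<Sum>k\<in>I. S k \<omega>) x))) \<partial>M)
    \<le> ennreal (op_trace (op_exp (\<lambda>x. H x + (\<Sum>k\<in>I. W k x))))"
  using I indep W mgf H
proof (induction I arbitrary: H rule: finite_induct)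
  case empty
  interpret D: bounded_bilinear D by (rule D)
  show ?case by (simp add: D.zero_left emeasure_space_1)
next
  case (insert k I)
  interpret D: bounded_bilinear D by (rule D)
  note H = insert.prems(4)
  define Z where "Z \<omega> = (\<Sum>i\<in>I. S i \<omega>)" for \<omega>
  have cont_D: "continuous_on UNIV (\<lambda>(s, x). D s x)"
    unfolding case_prod_beta by (intro D.continuous_on continuous_intros)
  have cont: "continuous_on UNIV (\<lambda>(s, x). H x + D s x)"
  proof -
    have "continuous_on UNIV (\<lambda>(p :: 'c \<times> 'e). H (snd p))"
      by (rule linear_continuous_on_compose[OF continuous_on_snd[OF continuous_on_id] self_adjointD(1)[OF H]])
    then show ?thesis
      unfolding case_prod_beta by (intro D.continuous_on continuous_intros)
  qed
  have HD: "self_adjoint (\<lambda>x. H x + D s x)" for s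
    by (intro self_adjoint_add H Dsa)
  define F where "F s = ennreal (op_trace (op_exp (\<lambda>x. H x + D s x)))" for s
  have F[measurable]: "F \<in> borel_measurable borel"
    unfolding F_def op_trace_def
    using borel_measurable_op_exp[OF cont HD]
    by (intro measurable_compose[OF _ measurable_ennreal] borel_measurable_sum borel_measurable_inner)
       auto
  have S[measurable]: "S k \<in> borel_measurable M"
    using insert.prems(1) by (auto simp: indep_vars_def)
  have "indep_var borel (S k) borel Z"
    unfolding Z_def by (rule indep_var_sum[OF insert.hyps insert.prems(1)])
  moreover have "(\<lambda>(s, z). F (z + s)) \<in> borel_measurable (borel \<Otimes>\<^sub>M borel)"
    by measurable
  ultimately have "(\<integral>\<^sup>+\<omega>. F (Z \<omega> + S k \<omega>) \<partial>M) = (\<integral>\<^sup>+\<omega>. (\<integral>\<^sup>+\<omega>'. F (Z \<omega> + S k \<omega>') \<partial>M) \<partial>M)"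
    by (rule nn_integral_indep_var)
  also have "\<dots> \<le> (\<integral>\<^sup>+\<omega>. ennreal (op_trace (op_exp (\<lambda>x. (H x + W k x) + D (Z \<omega>) x))) \<partial>M)"
  proof (rule nn_integral_mono)
    fix \<omega>
    have "(\<integral>\<^sup>+\<omega>'. ennreal (op_trace (op_exp (\<lambda>x. (H x + D (Z \<omega>) x) + D (S k \<omega>') x))) \<partial>M)
        \<le> ennreal (op_trace (op_exp (\<lambda>x. (H x + D (Z \<omega>) x) + W k x)))"
    proof (rule trace_exp_expectation_le[OF HD _ Dsa])
      show "self_adjoint (W k)" by (rule insert.prems(2)) simp
      show "(\<integral>\<^sup>+\<omega>. ennreal (x \<bullet> op_exp (D (S k \<omega>)) x) \<partial>M) \<le> ennreal (x \<bullet> op_exp (W k) x)" for x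
        by (rule insert.prems(3)) simp
      show "(\<lambda>\<omega>. x \<bullet> op_exp (D (S k \<omega>)) x) \<in> borel_measurable M" for x
        using measurable_compose[OF S borel_measurable_op_exp[OF cont_D Dsa]]
        by (intro borel_measurable_inner) auto
    qed
    moreover have "F (Z \<omega> + S k \<omega>') = ennreal (op_trace (op_exp (\<lambda>x. (H x + D (Z \<omega>) x) + D (S k \<omega>') x)))"
      for \<omega>'
      by (simp add: F_def D.add_left add.assoc)
    moreover have "(\<lambda>x. (H x + W k x) + D (Z \<omega>) x) = (\<lambda>x. (H x + D (Z \<omega>) x) + W k x)"
      by (simp add: fun_eq_iff)
    ultimately show "(\<integral>\<^sup>+\<omega>'. F (Z \<omega> + S k \<omega>') \<partial>M)
        \<le> ennreal (op_trace (op_exp (\<lambda>x. (H x + W k x) + D (Z \<omega>) x)))"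
      by simp
  qed
  also have "\<dots> \<le> ennreal (op_trace (op_exp (\<lambda>x. (H x + W k x) + (\<Sum>i\<in>I. W i x))))"
    unfolding Z_def
  proof (rule insert.IH)
    show "indep_vars (\<lambda>_. borel) S I" using insert.prems(1) by (rule indep_vars_subset) auto
    show "self_adjoint (\<lambda>x. H x + W k x)"
      by (intro self_adjoint_add H insert.prems(2)) simp
    show "self_adjoint (W i)" if "i \<in> I" for i
      using that by (intro insert.prems(2)) simp
    show "(\<integral>\<^sup>+\<omega>. ennreal (x \<bullet> op_exp (D (S i \<omega>)) x) \<partial>M) \<le> ennreal (x \<bullet> op_exp (W i) x)"
      if "i \<in> I" for i x
      using that by (intro insert.prems(3)) simp
  qed
  finally have le: "(\<integral>\<^sup>+\<omega>. F (Z \<omega> + S k \<omega>) \<partial>M)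
      \<le> ennreal (op_trace (op_exp (\<lambda>x. (H x + W k x) + (\<Sum>i\<in>I. W i x))))" .
  have "(\<Sum>i\<in>insert k I. S i \<omega>) = Z \<omega> + S k \<omega>" for \<omega>
    unfolding Z_def sum.insert[OF insert.hyps] by (rule add.commute)
  moreover have "(\<lambda>x. H x + (\<Sum>i\<in>insert k I. W i x)) = (\<lambda>x. (H x + W k x) + (\<Sum>i\<in>I. W i x))"
    by (simp add: fun_eq_iff insert.hyps add.assoc)
  ultimately show ?case
    using le by (simp only: F_def)
qed

end

section \<open>A quadratic bound for the exponential\<close>

text \<open>Bernstein's scalar estimate, from (k + 2)! >= 2 * 3^k and a geometric series.\<close>
lemma exp_le_quadratic:
  fixes l L \<theta> :: real
  assumes l: "\<bar>l\<bar> \<le> L" and \<theta>: "0 \<le> \<theta>" "\<theta> * L < 3"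
  shows "exp (\<theta> * l) \<le> 1 + \<theta> * l + (\<theta>\<^sup>2 / 2 / (1 - \<theta> * L / 3)) * l\<^sup>2"
proof -
  define u where "u = \<theta> * l"
  define a where "a = \<theta> * L"
  have ua: "\<bar>u\<bar> \<le> a" using l \<theta> by (simp add: u_def a_def abs_mult mult_left_mono)
  have a: "0 \<le> a" "a < 3" using ua \<theta> by (auto simp: a_def)
  have fact_ge: "2 * 3 ^ k \<le> (fact (k + 2) :: real)" for k
  proof (induction k)
    case (Suc k)
    have "2 * 3 ^ Suc k \<le> (real k + 3) * (fact (k + 2) :: real)"
      using mult_mono[of 3 "real k + 3" "2 * 3 ^ k" "fact (k + 2)"] Suc by simp
    also have "\<dots> = fact (Suc k + 2)" by (simp add: algebra_simps)
    finally show ?case .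
  qed simp
  have "(\<lambda>k. u ^ k /\<^sub>R fact k) sums exp u" by (rule exp_converges)
  then have "(\<lambda>k. u ^ (k + 2) /\<^sub>R fact (k + 2)) sums (exp u - (\<Sum>k<2. u ^ k /\<^sub>R fact k))"
    by (rule sums_split_initial_segment)
  then have s1: "(\<lambda>k. u ^ (k + 2) / fact (k + 2)) sums (exp u - 1 - u)"
    by (simp add: eval_nat_numeral divide_inverse mult.commute diff_diff_eq)
  have s2: "(\<lambda>k. u\<^sup>2 / 2 * (a / 3) ^ k) sums (u\<^sup>2 / 2 * (1 / (1 - a / 3)))"
    using a by (intro sums_mult geometric_sums) simp
  have "u ^ (k + 2) / fact (k + 2) \<le> u\<^sup>2 / 2 * (a / 3) ^ k" for k
  proof -
    have "u ^ (k + 2) \<le> \<bar>u\<bar> ^ (k + 2)"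
      using abs_ge_self[of "u ^ (k + 2)"] by (simp only: power_abs)
    also have "\<dots> = \<bar>u\<bar> ^ k * u\<^sup>2" by (simp only: power_add power2_abs)
    also have "\<dots> \<le> a ^ k * u\<^sup>2"
      using ua by (intro mult_right_mono power_mono) auto
    finally have "u ^ (k + 2) / fact (k + 2) \<le> a ^ k * u\<^sup>2 / fact (k + 2)"
      by (intro divide_right_mono) auto
    also have "\<dots> \<le> a ^ k * u\<^sup>2 / (2 * 3 ^ k)"
      using a fact_ge[of k] by (intro divide_left_mono) auto
    finally show ?thesis by (simp add: power_divide mult_ac)
  qed
  then have "exp u - 1 - u \<le> u\<^sup>2 / 2 * (1 / (1 - a / 3))"
    by (rule sums_le[OF _ s1 s2])
  then show ?thesis
    by (simp add: u_def a_def power_mult_distrib mult_ac)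
qed

text \<open>The scalar estimate holds at every eigenvalue of A, and the quadratic forms of 1, A, A^2 and
  exp(\<theta> A) are sums over a common eigenbasis.\<close>
lemma inner_op_exp_le_quadratic:
  fixes A :: "'a::euclidean_space \<Rightarrow> 'a"
  assumes A: "self_adjoint A" and L: "\<And>x. norm (A x) \<le> L * norm x"
    and \<theta>: "0 \<le> \<theta>" "\<theta> * L < 3"
  shows "x \<bullet> op_exp (\<lambda>x. \<theta> *\<^sub>R A x) x
    \<le> x \<bullet> x + \<theta> * (x \<bullet> A x) + (\<theta>\<^sup>2 / 2 / (1 - \<theta> * L / 3)) * (A x \<bullet> A x)"
proof -
  obtain B where B: "eigenbasis A B" by (rule eigenbasis_exists[OF A])
  note B' = eigenbasisD(1)[OF B] and lin = self_adjointD(1)[OF A]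
  have "\<bar>b \<bullet> A b\<bar> \<le> L" if "b \<in> B" for b
  proof -
    have b: "norm b = 1" using B' that by (simp add: orthonormal_basis_def)
    have "\<bar>b \<bullet> A b\<bar> \<le> norm b * norm (A b)" by (rule Cauchy_Schwarz_ineq2)
    then show ?thesis using L[of b] b by simp
  qed
  note bound = exp_le_quadratic[OF this \<theta>]
  have sq: "(A x \<bullet> b)\<^sup>2 = (b \<bullet> A b)\<^sup>2 * (x \<bullet> b)\<^sup>2" if "b \<in> B" for b
  proof -
    have "A x \<bullet> b = x \<bullet> A b" using A by (simp add: self_adjoint_def)
    also have "\<dots> = (b \<bullet> A b) * (x \<bullet> b)"
      by (subst eigenbasisD(3)[OF B that]) simp
    finally show ?thesis by (simp add: power_mult_distrib)
  qed
  have "x \<bullet> op_exp (\<lambda>x. \<theta> *\<^sub>R A x) x = (\<Sum>b\<in>B. exp (\<theta> * (b \<bullet> A b)) * (x \<bullet> b)\<^sup>2)"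
    using inner_op_exp[OF eigenbasis_scaleR[OF B] self_adjointD(1)[OF self_adjoint_scaleR[OF A]]] by simp
  also have "\<dots> \<le> (\<Sum>b\<in>B. (1 + \<theta> * (b \<bullet> A b) + (\<theta>\<^sup>2 / 2 / (1 - \<theta> * L / 3)) * (b \<bullet> A b)\<^sup>2) * (x \<bullet> b)\<^sup>2)"
    by (intro sum_mono mult_right_mono bound) auto
  also have "\<dots> = (\<Sum>b\<in>B. (x \<bullet> b)\<^sup>2) + \<theta> * (\<Sum>b\<in>B. (b \<bullet> A b) * (x \<bullet> b)\<^sup>2)
      + (\<theta>\<^sup>2 / 2 / (1 - \<theta> * L / 3)) * (\<Sum>b\<in>B. (A x \<bullet> b)\<^sup>2)"
    unfolding sum_distrib_left sum.distrib[symmetric]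
    by (intro sum.cong refl) (simp add: sq algebra_simps)
  also have "\<dots> = x \<bullet> x + \<theta> * (x \<bullet> A x) + (\<theta>\<^sup>2 / 2 / (1 - \<theta> * L / 3)) * (A x \<bullet> A x)"
    by (simp only: orthonormal_basis_norm_squared[OF B'] inner_self_adjoint[OF B lin, symmetric])
  finally show ?thesis .
qed

lemma inner_op_exp_ge_linear:
  fixes A :: "'a::euclidean_space \<Rightarrow> 'a"
  assumes A: "self_adjoint A"
  shows "x \<bullet> x + x \<bullet> A x \<le> x \<bullet> op_exp A x"
proof -
  obtain B where B: "eigenbasis A B" by (rule eigenbasis_exists[OF A])
  note lin = self_adjointD(1)[OF A]
  have "x \<bullet> x + x \<bullet> A x = (\<Sum>b\<in>B. (1 + b \<bullet> A b) * (x \<bullet> b)\<^sup>2)"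
    unfolding inner_self_adjoint[OF B lin, of x]
      orthonormal_basis_norm_squared[OF eigenbasisD(1)[OF B], of x, symmetric]
    by (simp add: algebra_simps flip: sum.distrib)
  also have "\<dots> \<le> (\<Sum>b\<in>B. exp (b \<bullet> A b) * (x \<bullet> b)\<^sup>2)"
    by (intro sum_mono mult_right_mono) auto
  finally show ?thesis by (simp add: inner_op_exp[OF B lin])
qed

text \<open>Since exp a >= e a for a >= 1, the claim 4 (a + 1) <= 3 exp a follows from e >= 8/3.\<close>
lemma exp_le_4_exp_minus:
  fixes a :: real
  assumes "1 \<le> a"
  shows "exp a \<le> 4 * (exp a - a - 1)"
proof -
  (* 25/18 is the value of the quadratic Taylor polynomial of exp at 1/3. *)
  have "8 / 3 \<le> (25 / 18 :: real) ^ 3" by (simp add: power3_eq_cube)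
  also have "\<dots> \<le> exp (1 / 3) ^ 3"
    using exp_lower_Taylor_quadratic[of "1 / 3"]
    by (intro power_mono) (simp_all add: power2_eq_square)
  also have "\<dots> = exp (1::real)" by (simp flip: exp_of_nat_mult)
  finally have "8 / 3 * (1 + (a - 1)) \<le> exp 1 * exp (a - 1)"
    using assms by (intro mult_mono exp_ge_add_one_self) auto
  then have "8 / 3 * a \<le> exp a" by (simp flip: exp_add)
  then show ?thesis using assms by simp
qed

section \<open>Complex matrices and the Hermitian dilation\<close>

text \<open>The inner product of complex vectors here is the real part of the Hermitian inner product, so
  the conjugate transpose is the adjoint for it as well.\<close>
lemma inner_ctranspose:
  fixes A :: "complex^'n^'m"
  shows "(A *v x) \<bullet> y = x \<bullet> (ctranspose A *v y)"
proof -
  have "(a * z) \<bullet> w = z \<bullet> (cnj a * w)" for a z w :: complex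
    by (simp add: inner_complex_def algebra_simps)
  then have "(A *v x) \<bullet> y = (\<Sum>i\<in>UNIV. \<Sum>j\<in>UNIV. x $ j \<bullet> (cnj (A $ i $ j) * y $ i))"
    by (simp add: inner_vec_def matrix_vector_mult_def inner_sum_left)
  also have "\<dots> = (\<Sum>j\<in>UNIV. \<Sum>i\<in>UNIV. x $ j \<bullet> (cnj (A $ i $ j) * y $ i))"
    by (rule sum.swap)
  finally show ?thesis
    by (simp add: inner_vec_def matrix_vector_mult_def inner_sum_right ctranspose_def)
qed

lemma ctranspose_ctranspose [simp]: "ctranspose (ctranspose A) = A"
  by (simp add: ctranspose_def vec_eq_iff)

lemma psd_inner_nonneg:
  fixes A :: "complex^'n^'n"
  assumes "psd A"
  shows "0 \<le> x \<bullet> (A *v x)"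
proof -
  have "x \<bullet> (A *v x) = Re (\<Sum>i\<in>UNIV. cnj (x $ i) * (A *v x) $ i)"
    by (simp add: inner_vec_def inner_complex_def)
  then show ?thesis using assms by (simp add: psd_def)
qed

lemma spectral_norm_bound:
  fixes A :: "complex^'n^'m"
  shows "norm (A *v x) \<le> spectral_norm A * norm x"
  unfolding spectral_norm_def by (rule onorm) simp

lemma spectral_norm_nonneg: "0 \<le> spectral_norm (A :: complex^'n^'m)"
  unfolding spectral_norm_def by (rule onorm_pos_le) simp

lemma spectral_norm_ctranspose_bound:
  fixes A :: "complex^'n^'m"
  shows "norm (ctranspose A *v y) \<le> spectral_norm A * norm y"
proof (cases "ctranspose A *v y = 0")
  case False
  let ?z = "ctranspose A *v y"
  have "norm ?z * norm ?z = (A *v ?z) \<bullet> y"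
    by (simp add: inner_ctranspose power2_norm_eq_inner flip: power2_eq_square)
  also have "\<dots> \<le> norm (A *v ?z) * norm y" by (rule norm_cauchy_schwarz)
  also have "\<dots> \<le> (spectral_norm A * norm ?z) * norm y"
    by (intro mult_right_mono spectral_norm_bound) simp
  finally have "norm ?z * norm ?z \<le> norm ?z * (spectral_norm A * norm y)" by (simp add: mult_ac)
  then show ?thesis using False by simp
qed (simp add: spectral_norm_nonneg)

text \<open>A block diagonal matrix is represented by its action on pairs of vectors, because inner product,
  norm and trace on a product space split into the contributions of the two factors.\<close>
definition block_op :: "complex^'m^'m \<Rightarrow> complex^'n^'n \<Rightarrow>
    (complex^'m) \<times> (complex^'n) \<Rightarrow> (complex^'m) \<times> (complex^'n)"
  where "block_op A B z = (A *v fst z, B *v snd z)"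

text \<open>The Hermitian dilation of a rectangular matrix. Its square is block diagonal with blocks S S* and
  S* S, and this is why the two variance matrices V1 and V2 appear together.\<close>
definition dilation :: "complex^'n^'m \<Rightarrow>
    (complex^'m) \<times> (complex^'n) \<Rightarrow> (complex^'m) \<times> (complex^'n)"
  where "dilation S z = (S *v snd z, ctranspose S *v fst z)"

lemma linear_block_op: "linear (block_op A B)"
  by (rule linearI) (simp_all add: block_op_def matrix_vector_right_distrib
      linear_cmul[OF matrix_vector_mul_linear])

lemma self_adjoint_block_op:
  assumes "hermitian A" "hermitian B"
  shows "self_adjoint (block_op A B)"
  using assms linear_block_op
  by (auto simp: self_adjoint_def hermitian_def block_op_def inner_prod_def inner_ctranspose)

lemma bounded_bilinear_dilation: "bounded_bilinear (dilation :: complex^'n^'m \<Rightarrow> _)"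
proof -
  have ct: "ctranspose (A + B) = ctranspose A + ctranspose B"
    "ctranspose (r *\<^sub>R A) = r *\<^sub>R ctranspose A" for A B :: "complex^'n^'m" and r
    by (simp_all add: ctranspose_def vec_eq_iff scaleR_complex.ctr complex_eq_iff)
  have sc: "(r *\<^sub>R A) *v x = r *\<^sub>R (A *v x)" for A :: "complex^'p^'q" and r x
    by (simp add: matrix_vector_mult_def vec_eq_iff scaleR_sum_right)
  have "bilinear (dilation :: complex^'n^'m \<Rightarrow> _)"
    unfolding bilinear_def
    by (auto intro!: linearI simp: dilation_def matrix_vector_right_distrib ct sc
        matrix_vector_mult_add_rdistrib linear_cmul[OF matrix_vector_mul_linear])
  then show ?thesis by (simp add: bilinear_conv_bounded_bilinear)
qed

lemma self_adjoint_dilation: "self_adjoint (dilation S)"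
proof -
  have "dilation S x \<bullet> y = x \<bullet> dilation S y" for x y
    using inner_ctranspose[of S] inner_ctranspose[of "ctranspose S"]
    by (simp add: dilation_def inner_prod_def)
  then show ?thesis
    using bounded_bilinear.bounded_linear_right[OF bounded_bilinear_dilation]
    by (simp add: self_adjoint_def linear_conv_bounded_linear)
qed

lemma dilation_dilation:
  "dilation S (dilation S z) = block_op (S ** ctranspose S) (ctranspose S ** S) z"
  by (simp add: dilation_def block_op_def matrix_vector_mul_assoc)

lemma norm_prod_le:
  assumes "norm a \<le> c * norm x" "norm b \<le> c * norm y" "0 \<le> c"
  shows "norm (a, b) \<le> c * norm (x, y)"
proof -
  have "(norm a)\<^sup>2 + (norm b)\<^sup>2 \<le> (c * norm x)\<^sup>2 + (c * norm y)\<^sup>2"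
    using assms by (intro add_mono power_mono) auto
  also have "\<dots> = (c * norm (x, y))\<^sup>2"
    by (simp add: norm_Pair power_mult_distrib algebra_simps)
  finally show ?thesis
    using assms(3) by (auto simp: norm_Pair intro!: real_le_lsqrt)
qed

lemma norm_dilation_le: "norm (dilation S z) \<le> spectral_norm S * norm z"
proof -
  have "norm (dilation S z) \<le> spectral_norm S * norm (snd z, fst z)"
    unfolding dilation_def
    by (intro norm_prod_le spectral_norm_bound spectral_norm_ctranspose_bound spectral_norm_nonneg)
  then show ?thesis by (cases z) (simp add: norm_Pair add.commute)
qed

lemma sum_Basis_prod:
  fixes f :: "'a::euclidean_space \<times> 'b::euclidean_space \<Rightarrow> real"
  shows "(\<Sum>b\<in>Basis. f b) = (\<Sum>u\<in>Basis. f (u, 0)) + (\<Sum>v\<in>Basis. f (0, v))"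
proof -
  have "(\<Sum>b\<in>Basis. f b) = (\<Sum>b\<in>(\<lambda>u. (u, 0)) ` Basis. f b) + (\<Sum>b\<in>(\<lambda>v. (0, v)) ` Basis. f b)"
    unfolding Basis_prod_def by (rule sum.union_disjoint) auto
  then show ?thesis by (simp add: sum.reindex inj_on_def)
qed

lemma op_trace_dilation: "op_trace (dilation S) = 0"
  by (simp add: op_trace_def sum_Basis_prod dilation_def)

lemma op_trace_matrix:
  fixes A :: "complex^'n^'n"
  shows "op_trace (\<lambda>x. A *v x) = 2 * Re (trace A)"
proof -
  have Basis: "Basis = (\<lambda>(i, u). axis i u) ` (UNIV \<times> (Basis :: complex set))"
    by (auto simp: Basis_vec_def)
  have inj: "inj_on (\<lambda>(i, u). axis i u :: complex^'n) (UNIV \<times> Basis)"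
    by (auto simp: inj_on_def axis_eq_axis)
  have "op_trace (\<lambda>x. A *v x)
      = (\<Sum>i\<in>UNIV. \<Sum>u\<in>Basis. axis i u \<bullet> (A *v axis i u))"
    unfolding op_trace_def Basis sum.reindex[OF inj] sum.cartesian_product
    by (simp add: case_prod_beta)
  also have "\<dots> = (\<Sum>i\<in>UNIV. \<Sum>u\<in>Basis. u \<bullet> (A $ i $ i * u))"
  proof -
    have "(A *v axis i u) $ i = A $ i $ i * u" for i u
      by (simp add: matrix_vector_mult_def axis_def if_distrib cong: if_cong)
    then show ?thesis by (simp add: inner_axis')
  qed
  also have "\<dots> = (\<Sum>i\<in>UNIV. 2 * Re (A $ i $ i))"
    by (simp add: Basis_complex_def inner_complex_def)
  finally show ?thesis by (simp add: trace_def sum_distrib_left)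
qed

lemma op_trace_block_op:
  "op_trace (block_op A B) = 2 * (Re (trace A) + Re (trace B))"
proof -
  have "op_trace (block_op A B) = op_trace (\<lambda>x. A *v x) + op_trace (\<lambda>x. B *v x)"
    by (simp add: op_trace_def sum_Basis_prod block_op_def)
  then show ?thesis by (simp add: op_trace_matrix)
qed

lemma sum_UNIV_Plus:
  fixes f :: "'m::finite + 'n::finite \<Rightarrow> 'b::comm_monoid_add"
  shows "(\<Sum>i\<in>UNIV. f i) = (\<Sum>a\<in>UNIV. f (Inl a)) + (\<Sum>b\<in>UNIV. f (Inr b))"
  by (simp add: sum.Plus flip: UNIV_Plus_UNIV)

lemma trace_block_diag:
  "trace (block_diag A B) = trace A + trace B"
  by (simp add: trace_def sum_UNIV_Plus block_diag_def)

lemma spectral_norm_block_diag_le: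
  "spectral_norm (block_diag A B) \<le> max (spectral_norm A) (spectral_norm B)"
  unfolding spectral_norm_def[of "block_diag A B"]
proof (rule onorm_le)
  fix x :: "complex^('a + 'b)"
  define p where "p = (\<chi> i. x $ Inl i)"
  define q where "q = (\<chi> i. x $ Inr i)"
  let ?v = "max (spectral_norm A) (spectral_norm B)"
  have comp: "(block_diag A B *v x) $ Inl i = (A *v p) $ i"
    "(block_diag A B *v x) $ Inr j = (B *v q) $ j" for i j
    by (simp_all add: matrix_vector_mult_def sum_UNIV_Plus block_diag_def p_def q_def)
  have norms: "norm y = norm (a, b)"
    if "\<And>i. y $ Inl i = a $ i" "\<And>j. y $ Inr j = b $ j" for y :: "complex^('a + 'b)" and a b
    using that by (simp add: norm_Pair norm_vec_def L2_set_def sum_UNIV_Plus sum_nonneg)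
  have "norm (A *v p) \<le> ?v * norm p" "norm (B *v q) \<le> ?v * norm q"
    using spectral_norm_bound[of A p] spectral_norm_bound[of B q]
    by (meson max.cobounded1 max.cobounded2 mult_right_mono norm_ge_zero order_trans)+
  then have "norm (A *v p, B *v q) \<le> ?v * norm (p, q)"
    by (rule norm_prod_le) (simp add: spectral_norm_nonneg max.coboundedI1)
  moreover have "norm (block_diag A B *v x) = norm (A *v p, B *v q)" by (rule norms) (auto simp: comp)
  moreover have "norm x = norm (p, q)" by (rule norms) (auto simp: p_def q_def)
  ultimately show "norm (block_diag A B *v x) \<le> ?v * norm x" by simp
qed

lemma spectral_norm_pos:
  fixes A :: "complex^'n^'m"
  assumes "A \<noteq> 0"
  shows "0 < spectral_norm A"
proof -
  have "A = 0" if "\<And>x. A *v x = 0"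
  proof -
    have "A $ i $ j = (A *v axis j 1) $ i" for i j
      by (simp add: matrix_vector_mult_def axis_def if_distrib cong: if_cong)
    then show ?thesis using that by (simp add: vec_eq_iff)
  qed
  then obtain x where "A *v x \<noteq> 0" using assms by blast
  then have "0 < norm (A *v x)" by simp
  with spectral_norm_bound[of A x] spectral_norm_nonneg[of A] show ?thesis
    by (cases "spectral_norm A = 0") auto
qed

lemma norm_le_spectral_norm:
  fixes A :: "complex^'n^'m"
  shows "norm A \<le> real CARD('m) * real CARD('n) * spectral_norm A"
proof -
  have "norm (A $ i $ j) \<le> spectral_norm A" for i j
  proof -
    have "A $ i $ j = (A *v axis j 1) $ i"
      by (simp add: matrix_vector_mult_def axis_def if_distrib cong: if_cong)
    then have "norm (A $ i $ j) \<le> norm (A *v axis j 1)"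
      using Finite_Cartesian_Product.norm_nth_le by metis
    moreover have "norm (axis j 1 :: complex^'n) = 1"
      by (simp add: norm_eq_sqrt_inner inner_axis_axis)
    ultimately show ?thesis using spectral_norm_bound[of A "axis j 1"] by simp
  qed
  then have "(\<Sum>i\<in>UNIV. \<Sum>j\<in>UNIV. norm (A $ i $ j)) \<le> (\<Sum>i\<in>(UNIV::'m set). \<Sum>j\<in>(UNIV::'n set). spectral_norm A)"
    by (intro sum_mono)
  moreover have "norm A \<le> (\<Sum>i\<in>UNIV. \<Sum>j\<in>UNIV. norm (A $ i $ j))"
    unfolding norm_vec_def[of A]
    by (rule order_trans[OF L2_set_le_sum sum_mono]) (simp_all add: norm_vec_def L2_set_le_sum)
  ultimately show ?thesis by (simp add: mult_ac)
qed

lemma ctranspose_mult: "ctranspose (A ** B) = ctranspose B ** ctranspose A"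
  by (simp add: ctranspose_def matrix_matrix_mult_def vec_eq_iff mult.commute)

lemma bounded_linear_ctranspose: "bounded_linear (ctranspose :: complex^'n^'m \<Rightarrow> _)"
  unfolding linear_conv_bounded_linear[symmetric]
  by (rule linearI) (simp_all add: ctranspose_def vec_eq_iff scaleR_complex.ctr complex_eq_iff)

lemma bounded_bilinear_matrix_mult:
  "bounded_bilinear ((**) :: complex^'n^'m \<Rightarrow> complex^'p^'n \<Rightarrow> _)"
  unfolding bilinear_conv_bounded_bilinear[symmetric] bilinear_def
  by (auto intro!: linearI simp: matrix_matrix_mult_def vec_eq_iff sum.distrib algebra_simps
      scaleR_sum_right)

lemma bounded_bilinear_outer:
  "bounded_bilinear (\<lambda>A B :: complex^'n^'m. A ** ctranspose B)"
  "bounded_bilinear (\<lambda>A B :: complex^'n^'m. ctranspose A ** B)"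
  using bounded_bilinear.comp[OF bounded_bilinear_matrix_mult bounded_linear_ident bounded_linear_ctranspose]
    bounded_bilinear.comp[OF bounded_bilinear_matrix_mult bounded_linear_ctranspose bounded_linear_ident]
  by simp_all

lemma bounded_linear_inner_mult:
  "bounded_linear (\<lambda>A :: complex^'n^'m. x \<bullet> (A *v y))"
  unfolding linear_conv_bounded_linear[symmetric]
  by (rule linearI) (simp_all add: matrix_vector_mult_def inner_vec_def sum.distrib algebra_simps
      inner_add_right sum_distrib_left inner_sum_right scaleR_sum_right)

lemma spectral_norm_attained:
  fixes A :: "complex^'n^'m"
  obtains y where "norm y = 1" "norm (A *v y) = spectral_norm A"
proof -
  have "continuous_on (sphere 0 1) (\<lambda>y. norm (A *v y))"
    by (intro continuous_intros linear_continuous_on) simp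
  moreover have "(axis undefined 1 :: complex^'n) \<in> sphere 0 1"
    unfolding mem_sphere_0 by (simp add: norm_eq_sqrt_inner inner_axis_axis)
  ultimately obtain y where y: "y \<in> sphere 0 1" "\<And>x. x \<in> sphere 0 1 \<Longrightarrow> norm (A *v x) \<le> norm (A *v y)"
    using continuous_attains_sup[OF compact_sphere] by (metis empty_iff)
  have "spectral_norm A \<le> norm (A *v y)"
    unfolding spectral_norm_def
  proof (rule onorm_le)
    fix x
    show "norm (A *v x) \<le> norm (A *v y) * norm x"
    proof (cases "x = 0")
      case False
      have "A *v ((1 / norm x) *\<^sub>R x) = (1 / norm x) *\<^sub>R (A *v x)"
        by (rule linear_cmul) simp
      with y(2)[of "(1 / norm x) *\<^sub>R x"] False show ?thesis
        by (simp add: field_simps)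
    qed simp
  qed
  moreover have "norm (A *v y) \<le> spectral_norm A"
    using spectral_norm_bound[of A y] y(1) by simp
  ultimately show thesis using that[of y] y(1) by simp
qed

lemma borel_measurable_spectral_norm:
  "(spectral_norm :: complex^'n^'m \<Rightarrow> real) \<in> borel_measurable borel"
proof (rule borel_measurableI_le)
  fix c :: real
  have "spectral_norm A \<le> c \<longleftrightarrow> (\<forall>x. norm (A *v x) \<le> c * norm x)" for A :: "complex^'n^'m"
  proof
    show "\<forall>x. norm (A *v x) \<le> c * norm x" if "spectral_norm A \<le> c"
      using that by (meson spectral_norm_bound mult_right_mono norm_ge_zero order_trans)
    show "spectral_norm A \<le> c" if "\<forall>x. norm (A *v x) \<le> c * norm x"
      using that unfolding spectral_norm_def by (intro onorm_le) simp
  qed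
  then have "{A \<in> space borel. spectral_norm A \<le> c} = (\<Inter>x. {A :: complex^'n^'m. norm (A *v x) \<le> c * norm x})"
    by auto
  moreover have "continuous_on UNIV (\<lambda>A :: complex^'n^'m. A *v x)" for x
  proof (rule linear_continuous_on)
    show "bounded_linear (\<lambda>A :: complex^'n^'m. A *v x)"
      unfolding linear_conv_bounded_linear[symmetric]
      by (rule linearI) (simp_all add: matrix_vector_mult_def vec_eq_iff sum.distrib algebra_simps scaleR_sum_right)
  qed
  ultimately have "closed {A \<in> space borel. spectral_norm (A :: complex^'n^'m) \<le> c}"
    by (auto intro!: closed_INT closed_Collect_le continuous_intros)
  then show "{A \<in> space borel. spectral_norm (A :: complex^'n^'m) \<le> c} \<in> sets borel" by simp
qed

text \<open>Let y be a unit vector with |S y| = \<sigma>, the spectral norm, and x = S y / \<sigma>. Then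
  u = (x, y) / sqrt 2 and its multiple by the imaginary unit are orthonormal over the
  reals, and the quadratic form of the dilation has the value \<sigma> at both.\<close>
lemma op_trace_op_exp_dilation_ge:
  fixes S :: "complex^'n^'m"
  assumes t: "0 < t" "t \<le> spectral_norm S" and \<theta>: "0 \<le> \<theta>"
  shows "2 * (exp (\<theta> * t) - \<theta> * t - 1)
    \<le> op_trace (op_exp (\<lambda>z. \<theta> *\<^sub>R dilation S z)) - DIM((complex^'m) \<times> (complex^'n))"
proof -
  obtain y where y: "norm y = 1" "norm (S *v y) = spectral_norm S" by (rule spectral_norm_attained)
  define \<sigma> where "\<sigma> = spectral_norm S"
  have \<sigma>: "\<sigma> > 0" using t by (simp add: \<sigma>_def)
  define x where "x = (1 / \<sigma>) *\<^sub>R (S *v y)"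
  have x: "norm x = 1" using y \<sigma> by (simp add: x_def \<sigma>_def)
  have xSy: "x \<bullet> (S *v y) = \<sigma>"
    using y(2) \<sigma> by (simp add: x_def power2_norm_eq_inner[symmetric] \<sigma>_def power2_eq_square)
  define u where "u = (1 / sqrt 2) *\<^sub>R (x, y)"
  define w where "w = (1 / sqrt 2) *\<^sub>R (\<i> *s x, \<i> *s y)"
  have i_inner: "(\<i> *s p) \<bullet> (\<i> *s q) = p \<bullet> q" for p q :: "complex^'k"
    by (simp add: inner_vec_def inner_complex_def add.commute)
  have i_orth: "p \<bullet> (\<i> *s p) = 0" for p :: "complex^'k"
    by (simp add: inner_vec_def inner_complex_def mult.commute)
  have i_mult: "S *v (\<i> *s q) = \<i> *s (S *v q)" for q
    by (simp add: vec.scale)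
  have quad: "(c *\<^sub>R (p, q)) \<bullet> dilation S (c *\<^sub>R (p, q)) = 2 * c\<^sup>2 * (p \<bullet> (S *v q))" for c p q
    using inner_ctranspose[of S q p]
    by (simp add: dilation_def inner_commute linear_cmul[OF matrix_vector_mul_linear] power2_eq_square)
  have norms: "norm ((1 / sqrt 2) *\<^sub>R (p, q)) = 1" if "p \<bullet> p = 1" "q \<bullet> q = 1"
    for p :: "complex^'m" and q :: "complex^'n"
    using that by (simp add: norm_eq_sqrt_inner inner_prod_def real_sqrt_divide)
  have xy: "x \<bullet> x = 1" "y \<bullet> y = 1" using x y(1) by (simp_all add: norm_eq_1)
  have u: "norm u = 1" and w: "norm w = 1"
    unfolding u_def w_def by (rule norms; simp add: xy i_inner)+
  have uw: "u \<bullet> w = 0" by (simp add: u_def w_def i_orth)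
  have Du: "u \<bullet> dilation S u = \<sigma>" and Dw: "w \<bullet> dilation S w = \<sigma>"
    unfolding u_def w_def quad by (simp_all add: i_mult i_inner xSy power_divide)
  have "\<theta> * t \<le> \<theta> * \<sigma>" using t \<theta> by (simp add: \<sigma>_def mult_left_mono)
  then have mono: "exp (\<theta> * t) - \<theta> * t \<le> exp (\<theta> * \<sigma>) - \<theta> * \<sigma>"
  proof -
    let ?a = "\<theta> * t" and ?b = "\<theta> * \<sigma>"
    assume ab: "?a \<le> ?b"
    have "?b - ?a \<le> exp ?a * (?b - ?a)"
      using ab t \<theta> mult_right_mono[of 1 "exp ?a" "?b - ?a"] by simp
    moreover have "exp ?a * (1 + (?b - ?a)) \<le> exp ?a * exp (?b - ?a)"
      by (intro mult_left_mono exp_ge_add_one_self) simp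
    ultimately show ?thesis by (simp add: exp_diff distrib_left)
  qed
  have trace: "op_trace (\<lambda>z. \<theta> *\<^sub>R dilation S z) = 0"
    using op_trace_dilation[of S] by (simp add: op_trace_def flip: sum_distrib_left)
  have "2 * (a - 1) \<le> T - N" if "a \<le> b" "c = 0" "(b - 1) + (b - 1) \<le> T - c - N" for a b c T N :: real
    using that by simp
  from this[OF mono trace two_vectors_op_trace_le[OF self_adjoint_scaleR[OF self_adjoint_dilation] u w uw,
        of \<theta> S, unfolded inner_scaleR_right Du Dw]]
  show ?thesis .
qed

section \<open>Moments of bounded random matrices\<close>

context prob_space
begin

lemma integrable_continuous_bounded:
  fixes X :: "'a \<Rightarrow> 'b::euclidean_space" and f :: "'b \<Rightarrow> 'c::{banach, second_countable_topology}"
  assumes X: "X \<in> borel_measurable M" and bd: "AE \<omega> in M. norm (X \<omega>) \<le> K"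
    and f: "continuous_on UNIV f"
  shows "integrable M (\<lambda>\<omega>. f (X \<omega>))"
proof -
  have "bounded (f ` cball 0 K)"
    by (intro compact_imp_bounded compact_continuous_image continuous_on_subset[OF f]) auto
  then obtain C where "\<forall>y\<in>f ` cball 0 K. norm y \<le> C"
    unfolding bounded_iff by blast
  then have C: "norm (f x) \<le> C" if "norm x \<le> K" for x
    using that by simp
  show ?thesis
  proof (rule integrable_const_bound[where B = C])
    show "AE \<omega> in M. norm (f (X \<omega>)) \<le> C" using bd by eventually_elim (rule C)
    show "(\<lambda>\<omega>. f (X \<omega>)) \<in> borel_measurable M"
      using measurable_compose[OF X borel_measurable_continuous_onI[OF f]] by simp
  qed
qed

lemma
  fixes X Y :: "'a \<Rightarrow> 'b::euclidean_space"
    and h :: "'b \<Rightarrow> 'b \<Rightarrow> 'd::{banach, second_countable_topology}"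
  assumes h: "bounded_bilinear h" and ind: "indep_var borel X borel Y"
    and X: "integrable M X" and Y: "integrable M Y"
  shows integrable_indep_bilinear: "integrable M (\<lambda>\<omega>. h (X \<omega>) (Y \<omega>))"
    and integral_indep_bilinear: "(\<integral>\<omega>. h (X \<omega>) (Y \<omega>) \<partial>M) = h (\<integral>\<omega>. X \<omega> \<partial>M) (\<integral>\<omega>. Y \<omega> \<partial>M)"
proof -
  interpret h: bounded_bilinear h by (rule h)
  have expand: "h x y = (\<Sum>b\<in>Basis. \<Sum>c\<in>Basis. ((x \<bullet> b) * (y \<bullet> c)) *\<^sub>R h b c)" for x y
  proof -
    have "h x y = h (\<Sum>b\<in>Basis. (x \<bullet> b) *\<^sub>R b) (\<Sum>c\<in>Basis. (y \<bullet> c) *\<^sub>R c)"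
      by (simp add: euclidean_representation)
    then show ?thesis
      by (subst sum.swap)
        (simp add: h.sum_left h.sum_right h.scaleR_left h.scaleR_right scaleR_sum_right mult.commute)
  qed
  have ind': "indep_var borel (\<lambda>\<omega>. X \<omega> \<bullet> b) borel (\<lambda>\<omega>. Y \<omega> \<bullet> c)" for b c
    using indep_var_compose[OF ind, of "\<lambda>x. x \<bullet> b" borel "\<lambda>y. y \<bullet> c" borel]
    by (simp add: comp_def)
  have Xb: "integrable M (\<lambda>\<omega>. X \<omega> \<bullet> b)" "integrable M (\<lambda>\<omega>. Y \<omega> \<bullet> c)" for b c
    using X Y by auto
  have int: "integrable M (\<lambda>\<omega>. (X \<omega> \<bullet> b) * (Y \<omega> \<bullet> c))" for b c
    by (rule indep_var_integrable[OF ind' Xb])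
  show "integrable M (\<lambda>\<omega>. h (X \<omega>) (Y \<omega>))"
    unfolding expand[of "X _"] by (intro Bochner_Integration.integrable_sum integrable_scaleR_left int)
  have "(\<integral>\<omega>. h (X \<omega>) (Y \<omega>) \<partial>M)
      = (\<Sum>b\<in>Basis. \<Sum>c\<in>Basis. (\<integral>\<omega>. (X \<omega> \<bullet> b) * (Y \<omega> \<bullet> c) \<partial>M) *\<^sub>R h b c)"
    unfolding expand[of "X _"] by (simp add: int Bochner_Integration.integral_sum)
  also have "\<dots> = (\<Sum>b\<in>Basis. \<Sum>c\<in>Basis. (((\<integral>\<omega>. X \<omega> \<partial>M) \<bullet> b) * ((\<integral>\<omega>. Y \<omega> \<partial>M) \<bullet> c)) *\<^sub>R h b c)"
    by (simp add: indep_var_lebesgue_integral[OF ind' Xb] integral_inner_left X Y)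
  finally show "(\<integral>\<omega>. h (X \<omega>) (Y \<omega>) \<partial>M) = h (\<integral>\<omega>. X \<omega> \<partial>M) (\<integral>\<omega>. Y \<omega> \<partial>M)"
    by (simp only: expand[of "expectation X" "expectation Y"])
qed

lemma indep_vars_pair:
  fixes S :: "'i \<Rightarrow> 'a \<Rightarrow> 'b::euclidean_space"
  assumes "indep_vars (\<lambda>_. borel) S I" "j \<in> I" "k \<in> I" "j \<noteq> k"
  shows "indep_var borel (S j) borel (S k)"
proof -
  have "indep_vars (\<lambda>_. borel) S (insert j {k})"
    using assms by (auto intro: indep_vars_subset)
  from indep_var_sum[OF _ _ this] assms(4) show ?thesis by simp
qed

text \<open>In the expansion of the product, the mixed terms have expectation h 0 0 = 0, by independence and centering.\<close>
lemma second_moment_sum: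
  fixes S :: "'i \<Rightarrow> 'a \<Rightarrow> 'b::euclidean_space"
    and h :: "'b \<Rightarrow> 'b \<Rightarrow> 'd::{banach, second_countable_topology}"
  assumes h: "bounded_bilinear h" and I: "finite I" and ind: "indep_vars (\<lambda>_. borel) S I"
    and int: "\<And>k. k \<in> I \<Longrightarrow> integrable M (S k)"
    and int2: "\<And>k. k \<in> I \<Longrightarrow> integrable M (\<lambda>\<omega>. h (S k \<omega>) (S k \<omega>))"
    and mean: "\<And>k. k \<in> I \<Longrightarrow> (\<integral>\<omega>. S k \<omega> \<partial>M) = 0"
  shows "(\<integral>\<omega>. h (\<Sum>k\<in>I. S k \<omega>) (\<Sum>k\<in>I. S k \<omega>) \<partial>M) = (\<Sum>k\<in>I. \<integral>\<omega>. h (S k \<omega>) (S k \<omega>) \<partial>M)"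
proof -
  interpret h: bounded_bilinear h by (rule h)
  have pair: "integrable M (\<lambda>\<omega>. h (S j \<omega>) (S k \<omega>))" if "j \<in> I" "k \<in> I" for j k
    using that int2 integrable_indep_bilinear[OF h indep_vars_pair[OF ind that] int int]
    by (cases "j = k") auto
  have "(\<integral>\<omega>. h (\<Sum>k\<in>I. S k \<omega>) (\<Sum>k\<in>I. S k \<omega>) \<partial>M)
      = (\<Sum>k\<in>I. \<Sum>j\<in>I. \<integral>\<omega>. h (S j \<omega>) (S k \<omega>) \<partial>M)"
    unfolding h.sum_left h.sum_right
    by (simp add: pair Bochner_Integration.integral_sum)
  also have "\<dots> = (\<Sum>k\<in>I. \<Sum>j\<in>I. if j = k then \<integral>\<omega>. h (S k \<omega>) (S k \<omega>) \<partial>M else 0)"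
    by (intro sum.cong refl)
      (auto simp: integral_indep_bilinear[OF h indep_vars_pair[OF ind] int int] mean h.zero_left)
  also have "\<dots> = (\<Sum>k\<in>I. \<integral>\<omega>. h (S k \<omega>) (S k \<omega>) \<partial>M)"
    using I by simp
  finally show ?thesis .
qed

lemma hermitian_second_moments:
  fixes X :: "'a \<Rightarrow> complex^'n^'m"
  assumes "integrable M (\<lambda>\<omega>. X \<omega> ** ctranspose (X \<omega>))"
    and "integrable M (\<lambda>\<omega>. ctranspose (X \<omega>) ** X \<omega>)"
  shows "hermitian (\<integral>\<omega>. X \<omega> ** ctranspose (X \<omega>) \<partial>M)"
    and "hermitian (\<integral>\<omega>. ctranspose (X \<omega>) ** X \<omega> \<partial>M)"
  using integral_bounded_linear[OF bounded_linear_ctranspose assms(1)]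
    integral_bounded_linear[OF bounded_linear_ctranspose assms(2)]
  by (simp_all add: hermitian_def ctranspose_mult)

lemma
  fixes X :: "'a \<Rightarrow> complex^'n^'m"
  assumes X: "X \<in> borel_measurable M" and bd: "AE \<omega> in M. spectral_norm (X \<omega>) \<le> L"
  shows integrable_spectral_bounded: "integrable M X"
    and integrable_outer: "integrable M (\<lambda>\<omega>. X \<omega> ** ctranspose (X \<omega>))"
      "integrable M (\<lambda>\<omega>. ctranspose (X \<omega>) ** X \<omega>)"
proof -
  have "AE \<omega> in M. norm (X \<omega>) \<le> real CARD('m) * real CARD('n) * L"
    using bd
  proof eventually_elim
    case (elim \<omega>)
    then show ?case
      by (intro order_trans[OF norm_le_spectral_norm] mult_left_mono) simp_all
  qed
  note int = integrable_continuous_bounded[OF X this]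
  show "integrable M X" using int[OF continuous_on_id] by simp
  show "integrable M (\<lambda>\<omega>. X \<omega> ** ctranspose (X \<omega>))"
    by (intro int bounded_bilinear.continuous_on[OF bounded_bilinear_outer(1)] continuous_intros)
  show "integrable M (\<lambda>\<omega>. ctranspose (X \<omega>) ** X \<omega>)"
    by (intro int bounded_bilinear.continuous_on[OF bounded_bilinear_outer(2)] continuous_intros)
qed

text \<open>The square of the dilation is block diagonal, with expectation W. Averaging the quadratic
  bound for the exponential removes the linear term and leaves 1 + g W, which is at most exp(g W).\<close>
lemma dilation_mgf_le:
  fixes X :: "'a \<Rightarrow> complex^'n^'m"
  assumes X: "X \<in> borel_measurable M" and bd: "AE \<omega> in M. spectral_norm (X \<omega>) \<le> L"
    and mean: "(\<integral>\<omega>. X \<omega> \<partial>M) = 0" and \<theta>: "0 \<le> \<theta>" "\<theta> * L < 3"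
  defines "W \<equiv> block_op (\<integral>\<omega>. X \<omega> ** ctranspose (X \<omega>) \<partial>M) (\<integral>\<omega>. ctranspose (X \<omega>) ** X \<omega> \<partial>M)"
    and "g \<equiv> \<theta>\<^sup>2 / 2 / (1 - \<theta> * L / 3)"
  shows "(\<integral>\<^sup>+\<omega>. ennreal (z \<bullet> op_exp (\<lambda>z. \<theta> *\<^sub>R dilation (X \<omega>) z) z) \<partial>M)
    \<le> ennreal (z \<bullet> op_exp (\<lambda>z. g *\<^sub>R W z) z)"
proof -
  note intX = integrable_spectral_bounded[OF X bd] and int1 = integrable_outer(1)[OF X bd]
    and int2 = integrable_outer(2)[OF X bd]
  have quad: "z \<bullet> dilation S z = fst z \<bullet> (S *v snd z) + fst z \<bullet> (S *v snd z)" for S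
    using inner_ctranspose[of S "snd z" "fst z"]
    by (simp add: dilation_def inner_prod_def inner_commute)
  have lin: "bounded_linear (\<lambda>S. z \<bullet> dilation S z)"
    unfolding quad by (rule bounded_linear_add[OF bounded_linear_inner_mult bounded_linear_inner_mult])
  have EX: "integrable M (\<lambda>\<omega>. z \<bullet> dilation (X \<omega>) z)" "(\<integral>\<omega>. z \<bullet> dilation (X \<omega>) z \<partial>M) = 0"
    using integrable_bounded_linear[OF lin intX] integral_bounded_linear[OF lin intX]
      linear_0[OF bounded_linear.linear[OF lin]] by (simp_all add: mean)
  have sq: "dilation S z \<bullet> dilation S z
      = fst z \<bullet> ((S ** ctranspose S) *v fst z) + snd z \<bullet> ((ctranspose S ** S) *v snd z)" for S
    using self_adjointD(2)[OF self_adjoint_dilation, of S z "dilation S z"]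
    by (simp add: dilation_dilation block_op_def inner_prod_def)
  have EXX: "integrable M (\<lambda>\<omega>. dilation (X \<omega>) z \<bullet> dilation (X \<omega>) z)"
    "(\<integral>\<omega>. dilation (X \<omega>) z \<bullet> dilation (X \<omega>) z \<partial>M) = z \<bullet> W z"
    unfolding sq W_def
    by (simp_all add: integrable_bounded_linear[OF bounded_linear_inner_mult] int1 int2
        integral_bounded_linear[OF bounded_linear_inner_mult] block_op_def inner_prod_def)
  have g: "g \<ge> 0" unfolding g_def using \<theta>(2) by (intro divide_nonneg_nonneg) auto
  have W: "self_adjoint (\<lambda>z. g *\<^sub>R W z)"
    unfolding W_def
    by (intro self_adjoint_scaleR self_adjoint_block_op hermitian_second_moments int1 int2)
  define q where "q \<omega> = z \<bullet> z + \<theta> * (z \<bullet> dilation (X \<omega>) z) + g * (dilation (X \<omega>) z \<bullet> dilation (X \<omega>) z)" for \<omega>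
  have AEq: "AE \<omega> in M. z \<bullet> op_exp (\<lambda>z. \<theta> *\<^sub>R dilation (X \<omega>) z) z \<le> q \<omega>"
    using bd
  proof eventually_elim
    case (elim \<omega>)
    have "norm (dilation (X \<omega>) z) \<le> L * norm z" for z
      using norm_dilation_le[of "X \<omega>" z] mult_right_mono[OF elim norm_ge_zero[of z]] by simp
    from inner_op_exp_le_quadratic[OF self_adjoint_dilation this \<theta>, of z]
    show ?case by (simp add: q_def g_def)
  qed
  have nonneg: "0 \<le> z \<bullet> op_exp (\<lambda>z. \<theta> *\<^sub>R dilation (X \<omega>) z) z" for \<omega>
    by (intro inner_op_exp_nonneg self_adjoint_scaleR self_adjoint_dilation)
  have q0: "AE \<omega> in M. 0 \<le> q \<omega>"
    using AEq by eventually_elim (use nonneg order_trans in blast)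
  have intq: "integrable M q" 
    unfolding q_def
    by (intro Bochner_Integration.integrable_add integrable_mult_right integrable_const EX(1) EXX(1))
  have "(\<integral>\<^sup>+\<omega>. ennreal (z \<bullet> op_exp (\<lambda>z. \<theta> *\<^sub>R dilation (X \<omega>) z) z) \<partial>M) \<le> (\<integral>\<^sup>+\<omega>. ennreal (q \<omega>) \<partial>M)"
    by (intro nn_integral_mono_AE eventually_mono[OF AEq] ennreal_leI)
  also have "\<dots> = ennreal (\<integral>\<omega>. q \<omega> \<partial>M)"
    by (rule nn_integral_eq_integral[OF intq q0])
  also have "(\<integral>\<omega>. q \<omega> \<partial>M) = z \<bullet> z + z \<bullet> (g *\<^sub>R W z)"
    unfolding q_def using EX EXX by (simp add: prob_space)
  also have "ennreal \<dots> \<le> ennreal (z \<bullet> op_exp (\<lambda>z. g *\<^sub>R W z) z)"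
    by (intro ennreal_leI inner_op_exp_ge_linear W)
  finally show ?thesis .
qed

end

section \<open>The intrinsic Bernstein inequality\<close>

context prob_space
begin

lemma trace_exp_dilation_sum_le:
  fixes S :: "'i \<Rightarrow> 'a \<Rightarrow> complex^'n^'m"
  assumes I: "finite I" and indep: "indep_vars (\<lambda>_. borel) S I"
    and mean: "\<And>k. k \<in> I \<Longrightarrow> (\<integral>\<omega>. S k \<omega> \<partial>M) = 0"
    and bd: "\<And>k. k \<in> I \<Longrightarrow> AE \<omega> in M. spectral_norm (S k \<omega>) \<le> L"
    and \<theta>: "0 \<le> \<theta>" "\<theta> * L < 3" and g: "g = \<theta>\<^sup>2 / 2 / (1 - \<theta> * L / 3)"
    and V: "hermitian V1" "hermitian V2"
    and V1: "loewner_ge V1 (\<Sum>k\<in>I. \<integral>\<omega>. S k \<omega> ** ctranspose (S k \<omega>) \<partial>M)"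
    and V2: "loewner_ge V2 (\<Sum>k\<in>I. \<integral>\<omega>. ctranspose (S k \<omega>) ** S k \<omega> \<partial>M)"
  shows "(\<integral>\<^sup>+\<omega>. ennreal (op_trace (op_exp (\<lambda>z. \<theta> *\<^sub>R dilation (\<Sum>k\<in>I. S k \<omega>) z))) \<partial>M)
    \<le> ennreal (op_trace (op_exp (\<lambda>z. g *\<^sub>R block_op V1 V2 z)))"
proof -
  define P where "P k = (\<integral>\<omega>. S k \<omega> ** ctranspose (S k \<omega>) \<partial>M)" for k
  define Q where "Q k = (\<integral>\<omega>. ctranspose (S k \<omega>) ** S k \<omega> \<partial>M)" for k
  have S: "S k \<in> borel_measurable M" if "k \<in> I" for k
    using indep that by (auto simp: indep_vars_def)
  have herm: "hermitian (P k)" "hermitian (Q k)" if "k \<in> I" for k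
    unfolding P_def Q_def
    by (intro hermitian_second_moments integrable_outer[OF S[OF that] bd[OF that]])+
  have g0: "0 \<le> g" unfolding g using \<theta>(2) by (intro divide_nonneg_nonneg) auto
  have scale: "dilation (\<theta> *\<^sub>R A) z = \<theta> *\<^sub>R dilation A z" for A :: "complex^'n^'m" and z
    by (rule bounded_bilinear.scaleR_left[OF bounded_bilinear_dilation])
  define D where "D A z = \<theta> *\<^sub>R dilation A z" for A :: "complex^'n^'m" and z
  have "D = (\<lambda>A. dilation (\<theta> *\<^sub>R A))"
    by (simp add: fun_eq_iff D_def scale)
  then have D: "bounded_bilinear D"
    using bounded_bilinear.comp1[OF bounded_bilinear_dilation bounded_linear_scaleR_right, of \<theta>]
    by simp
  have Dsa: "self_adjoint (D A)" for A
    unfolding D_def[abs_def] by (intro self_adjoint_scaleR self_adjoint_dilation)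
  have Wsa: "self_adjoint (\<lambda>z. g *\<^sub>R block_op (P k) (Q k) z)" if "k \<in> I" for k
    by (intro self_adjoint_scaleR self_adjoint_block_op herm that)
  have zero: "self_adjoint (\<lambda>z :: (complex^'m) \<times> (complex^'n). 0)"
    by (simp add: self_adjoint_def linear_zero)
  have mgf: "(\<integral>\<^sup>+\<omega>. ennreal (z \<bullet> op_exp (D (S k \<omega>)) z) \<partial>M)
      \<le> ennreal (z \<bullet> op_exp (\<lambda>z. g *\<^sub>R block_op (P k) (Q k) z) z)" if "k \<in> I" for k z
    using dilation_mgf_le[OF S[OF that] bd[OF that] mean[OF that] \<theta>, of z]
    unfolding D_def[abs_def] P_def Q_def g .
  have "(\<integral>\<^sup>+\<omega>. ennreal (op_trace (op_exp (\<lambda>z. 0 + D (\<Sum>k\<in>I. S k \<omega>) z))) \<partial>M)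
      \<le> ennreal (op_trace (op_exp (\<lambda>z. 0 + (\<Sum>k\<in>I. g *\<^sub>R block_op (P k) (Q k) z))))"
    by (rule trace_mgf_sum_le[OF D Dsa I indep Wsa mgf zero])
  also have "\<dots> \<le> ennreal (op_trace (op_exp (\<lambda>z. g *\<^sub>R block_op V1 V2 z)))"
    unfolding add_0
  proof (intro ennreal_leI op_trace_op_exp_mono self_adjoint_sum self_adjoint_scaleR
      self_adjoint_block_op V herm)
    fix z :: "(complex^'m) \<times> (complex^'n)"
    have lin: "linear (\<lambda>A :: complex^'k^'k. x \<bullet> (A *v x))" for x :: "complex^'k"
      by (rule bounded_linear.linear[OF bounded_linear_inner_mult])
    have "z \<bullet> (\<Sum>k\<in>I. block_op (P k) (Q k) z)
        = fst z \<bullet> ((\<Sum>k\<in>I. P k) *v fst z) + snd z \<bullet> ((\<Sum>k\<in>I. Q k) *v snd z)"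
      unfolding linear_sum[OF lin] inner_sum_right
      by (simp add: block_op_def inner_prod_def sum.distrib)
    also have "\<dots> \<le> z \<bullet> block_op V1 V2 z"
      using psd_inner_nonneg[OF V1[unfolded loewner_ge_def], of "fst z"]
        psd_inner_nonneg[OF V2[unfolded loewner_ge_def], of "snd z"]
      unfolding linear_diff[OF lin] by (simp add: block_op_def inner_prod_def P_def Q_def)
    finally show "z \<bullet> (\<Sum>k\<in>I. g *\<^sub>R block_op (P k) (Q k) z) \<le> z \<bullet> g *\<^sub>R block_op V1 V2 z"
      using g0 by (simp add: scaleR_sum_right[symmetric] mult_left_mono)
  qed
  finally show ?thesis by (simp add: D_def[abs_def])
qed

lemma second_moment_inner_nonneg:
  fixes X :: "'a \<Rightarrow> complex^'n^'m"
  assumes int: "integrable M (\<lambda>\<omega>. X \<omega> ** ctranspose (X \<omega>))"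
    "integrable M (\<lambda>\<omega>. ctranspose (X \<omega>) ** X \<omega>)"
  shows "0 \<le> x \<bullet> ((\<integral>\<omega>. X \<omega> ** ctranspose (X \<omega>) \<partial>M) *v x)"
    and "0 \<le> y \<bullet> ((\<integral>\<omega>. ctranspose (X \<omega>) ** X \<omega> \<partial>M) *v y)"
proof -
  have "x \<bullet> ((A ** ctranspose A) *v x) = (ctranspose A *v x) \<bullet> (ctranspose A *v x)"
    "y \<bullet> ((ctranspose A ** A) *v y) = (A *v y) \<bullet> (A *v y)" for A :: "complex^'n^'m"
    using inner_ctranspose[of "ctranspose A" x "ctranspose A *v x"] inner_ctranspose[of A y "A *v y"]
    by (simp_all add: matrix_vector_mul_assoc)
  then have "0 \<le> x \<bullet> ((A ** ctranspose A) *v x)" "0 \<le> y \<bullet> ((ctranspose A ** A) *v y)"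
    for A :: "complex^'n^'m"
    by simp_all
  then show "0 \<le> x \<bullet> ((\<integral>\<omega>. X \<omega> ** ctranspose (X \<omega>) \<partial>M) *v x)"
    and "0 \<le> y \<bullet> ((\<integral>\<omega>. ctranspose (X \<omega>) ** X \<omega> \<partial>M) *v y)"
    unfolding integral_bounded_linear[OF bounded_linear_inner_mult int(1), symmetric]
      integral_bounded_linear[OF bounded_linear_inner_mult int(2), symmetric]
    by (auto intro!: Bochner_Integration.integral_nonneg)
qed

text \<open>Markov's inequality in the form that 2 psi(\<theta> t) times the indicator of the event, added to the
  real dimension N, is bounded by the trace exponential of the dilation. The expectation of the
  latter is compared with the chord bound, in which N cancels. For L >= 0 the
  denominator v + L t / 3 is positive, as the choice of \<theta> requires.\<close>
lemma matrix_bernstein_tail: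
  fixes S :: "'i \<Rightarrow> 'a \<Rightarrow> complex^'n^'m"
  assumes I: "finite I" and indep: "indep_vars (\<lambda>_. borel) S I"
    and mean: "\<And>k. k \<in> I \<Longrightarrow> (\<integral>\<omega>. S k \<omega> \<partial>M) = 0"
    and bd: "\<And>k. k \<in> I \<Longrightarrow> AE \<omega> in M. spectral_norm (S k \<omega>) \<le> L"
    and V: "hermitian V1" "hermitian V2"
    and V1: "loewner_ge V1 (\<Sum>k\<in>I. \<integral>\<omega>. S k \<omega> ** ctranspose (S k \<omega>) \<partial>M)"
    and V2: "loewner_ge V2 (\<Sum>k\<in>I. \<integral>\<omega>. ctranspose (S k \<omega>) ** S k \<omega> \<partial>M)"
    and psd: "\<And>z. 0 \<le> z \<bullet> block_op V1 V2 z"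
    and v: "v = max (spectral_norm V1) (spectral_norm V2)" "0 < v" and L: "0 \<le> L"
    and t: "sqrt v + L / 3 \<le> t"
  shows "prob {\<omega> \<in> space M. t \<le> spectral_norm (\<Sum>k\<in>I. S k \<omega>)}
    \<le> 4 * ((Re (trace V1) + Re (trace V2)) / v) * exp ((- (t\<^sup>2 / 2)) / (v + L * t / 3))"
proof -
  define w where "w = v + L * t / 3"
  (* With this choice, 1 - \<theta> L / 3 = v / w and g v - \<theta> t = - t^2 / (2 w). *)
  define \<theta> where "\<theta> = t / w"
  define g where "g = \<theta>\<^sup>2 / 2 / (1 - \<theta> * L / 3)"
  define e where "e = (Re (trace V1) + Re (trace V2)) / v"
  have t0: "0 < t" using t L real_sqrt_gt_zero[OF v(2)] by linarith
  have w0: "0 < w" using v(2) L t0 by (simp add: w_def add_pos_nonneg)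
  have \<theta>0: "0 \<le> \<theta>" using t0 w0 by (simp add: \<theta>_def)
  have comp: "1 - \<theta> * L / 3 = v / w" using w0 by (simp add: \<theta>_def w_def field_simps)
  have "0 < v / w" using v(2) w0 by simp
  then have \<theta>L: "\<theta> * L < 3" using comp by linarith
  have g0: "0 \<le> g" unfolding g_def comp using v(2) w0 by simp
  have gv: "g * v = t\<^sup>2 / (2 * w)"
    using v(2) w0 unfolding g_def comp by (simp add: \<theta>_def power2_eq_square field_simps)
  have \<theta>t: "\<theta> * t = t\<^sup>2 / w" by (simp add: \<theta>_def power2_eq_square)
  have "w \<le> t\<^sup>2"
  proof -
    have "sqrt v * sqrt v \<le> t * (t - L / 3)"
      using t L v(2) t0 by (intro mult_mono) auto
    then show ?thesis using v(2) by (simp add: w_def power2_eq_square algebra_simps)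
  qed
  then have \<theta>t1: "1 \<le> \<theta> * t" using w0 by (simp add: \<theta>t)
  define \<psi> where "\<psi> = exp (\<theta> * t) - \<theta> * t - 1"
  have \<psi>: "exp (\<theta> * t) \<le> 4 * \<psi>" unfolding \<psi>_def by (rule exp_le_4_exp_minus[OF \<theta>t1])
  then have \<psi>0: "0 < \<psi>" using exp_gt_zero[of "\<theta> * t"] by linarith
  let ?Z = "\<lambda>\<omega>. \<Sum>k\<in>I. S k \<omega>"
  define N where "N = real DIM((complex^'m) \<times> (complex^'n))"
  let ?V = "block_op V1 V2"
  define A where "A = {\<omega> \<in> space M. t \<le> spectral_norm (?Z \<omega>)}"
  have "S k \<in> borel_measurable M" if "k \<in> I" for k
    using indep that by (auto simp: indep_vars_def)
  then have Z: "?Z \<in> borel_measurable M" by (rule borel_measurable_sum)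
  have A[measurable]: "A \<in> sets M"
    unfolding A_def using measurable_compose[OF Z borel_measurable_spectral_norm] by measurable
  have pointwise: "N + 2 * \<psi> * indicator A \<omega> \<le> op_trace (op_exp (\<lambda>z. \<theta> *\<^sub>R dilation (?Z \<omega>) z))"
    if "\<omega> \<in> space M" for \<omega>
  proof (cases "\<omega> \<in> A")
    case True
    then show ?thesis
      using op_trace_op_exp_dilation_ge[OF t0 _ \<theta>0, of "?Z \<omega>"] by (simp add: A_def \<psi>_def N_def)
  next
    case False
    let ?D = "\<lambda>z. \<theta> *\<^sub>R dilation (?Z \<omega>) z"
    have "(\<Sum>b\<in>Basis. b \<bullet> b + b \<bullet> ?D b) \<le> op_trace (op_exp ?D)"
      unfolding op_trace_def[of "op_exp _"]
      by (intro sum_mono inner_op_exp_ge_linear self_adjoint_scaleR self_adjoint_dilation)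
    moreover have "(\<Sum>b\<in>Basis. b \<bullet> b + b \<bullet> ?D b) = N + \<theta> * op_trace (dilation (?Z \<omega>))"
      by (simp add: sum.distrib op_trace_def sum_distrib_left N_def)
    ultimately show ?thesis using False by (simp add: op_trace_dilation)
  qed
  have N0: "0 \<le> N" by (simp add: N_def)
  have "ennreal (N + 2 * \<psi> * prob A) = ennreal N + ennreal (2 * \<psi>) * emeasure M A"
    unfolding emeasure_eq_measure using \<psi>0 N0 by (simp add: ennreal_plus ennreal_mult)
  also have "\<dots> = (\<integral>\<^sup>+\<omega>. ennreal N + ennreal (2 * \<psi>) * indicator A \<omega> \<partial>M)"
    by (subst nn_integral_add) (simp_all add: nn_integral_cmult_indicator emeasure_space_1)
  also have "\<dots> \<le> (\<integral>\<^sup>+\<omega>. ennreal (op_trace (op_exp (\<lambda>z. \<theta> *\<^sub>R dilation (?Z \<omega>) z))) \<partial>M)"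
  proof (rule nn_integral_mono)
    fix \<omega> assume "\<omega> \<in> space M"
    from ennreal_leI[OF pointwise[OF this]]
    show "ennreal N + ennreal (2 * \<psi>) * indicator A \<omega>
        \<le> ennreal (op_trace (op_exp (\<lambda>z. \<theta> *\<^sub>R dilation (?Z \<omega>) z)))"
      using \<psi>0 N0 by (cases "\<omega> \<in> A") (simp_all add: ennreal_plus)
  qed
  also have "\<dots> \<le> ennreal (op_trace (op_exp (\<lambda>z. g *\<^sub>R ?V z)))"
    by (rule trace_exp_dilation_sum_le[OF I indep mean bd \<theta>0 \<theta>L g_def V V1 V2])
  finally have main: "N + 2 * \<psi> * prob A \<le> op_trace (op_exp (\<lambda>z. g *\<^sub>R ?V z))"
    by (subst (asm) ennreal_le_iff)
      (auto intro!: op_trace_op_exp_nonneg self_adjoint_scaleR self_adjoint_block_op V)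
  have "z \<bullet> ?V z \<le> v * (z \<bullet> z)" for z
  proof -
    have "norm (?V z) \<le> v * norm (fst z, snd z)"
      unfolding block_op_def
    proof (rule norm_prod_le)
      show "norm (V1 *v fst z) \<le> v * norm (fst z)"
        by (rule order_trans[OF spectral_norm_bound mult_right_mono]) (simp_all add: v(1))
      show "norm (V2 *v snd z) \<le> v * norm (snd z)"
        by (rule order_trans[OF spectral_norm_bound mult_right_mono]) (simp_all add: v(1))
    qed (use v(2) in simp)
    then have "norm z * norm (?V z) \<le> norm z * (v * norm z)" by (intro mult_left_mono) simp_all
    then show ?thesis
      using norm_cauchy_schwarz[of z "?V z"] by (simp add: power2_norm_eq_inner[symmetric] power2_eq_square mult_ac)
  qed
  from op_trace_op_exp_le_chord[OF self_adjoint_block_op[OF V] g0 v(2) psd this]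
  have "op_trace (op_exp (\<lambda>z. g *\<^sub>R ?V z)) - N \<le> 2 * e * (exp (g * v) - 1)"
    by (simp add: op_trace_block_op e_def N_def)
  with main have "\<psi> * prob A \<le> e * (exp (g * v) - 1)" by simp
  also have e0: "0 \<le> e"
  proof -
    have "0 \<le> op_trace ?V" unfolding op_trace_def by (intro sum_nonneg psd)
    then show ?thesis using v(2) by (simp add: e_def op_trace_block_op)
  qed
  then have "e * (exp (g * v) - 1) \<le> e * exp (g * v)" by (intro mult_left_mono) simp_all
  finally have "\<psi> * prob A \<le> e * exp (g * v)" .
  moreover have "exp (\<theta> * t) * prob A \<le> 4 * (\<psi> * prob A)"
    using mult_right_mono[OF \<psi>, of "prob A"] by simp
  ultimately have "exp (\<theta> * t) * prob A \<le> 4 * e * exp (g * v)" by linarith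
  then have "prob A \<le> 4 * e * exp (g * v) / exp (\<theta> * t)"
    by (simp add: pos_le_divide_eq mult.commute)
  also have "\<dots> = 4 * e * exp (g * v - \<theta> * t)" by (simp add: exp_diff)
  also have "g * v - \<theta> * t = (- (t\<^sup>2 / 2)) / (v + L * t / 3)"
    unfolding gv \<theta>t w_def[symmetric] by (simp add: field_simps)
  finally show ?thesis by (simp add: A_def e_def)
qed

end

theorem theorem7p3p1:
  fixes M :: "'a measure"
    and I :: "'i set"
    and S :: "'i \<Rightarrow> 'a \<Rightarrow> complex^'n^'m"
    and Z :: "'a \<Rightarrow> complex^'n^'m"
    and V1 :: "complex^'m^'m"
    and V2 :: "complex^'n^'n"
    and L d v :: real
  assumes "prob_space M"
    and "finite I"
    and "prob_space.indep_vars M (\<lambda>_. borel) S I"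
    and "\<And>k. k \<in> I \<Longrightarrow> (\<integral>\<omega>. S k \<omega> \<partial>M) = 0"
    and "\<And>k. k \<in> I \<Longrightarrow> AE \<omega> in M. spectral_norm (S k \<omega>) \<le> L"
    and "Z = (\<lambda>\<omega>. \<Sum>k\<in>I. S k \<omega>)"
    and "hermitian V1"
    and "hermitian V2"
    and "loewner_ge V1 (\<integral>\<omega>. Z \<omega> ** ctranspose (Z \<omega>) \<partial>M)"
    and "loewner_ge V2 (\<integral>\<omega>. ctranspose (Z \<omega>) ** Z \<omega> \<partial>M)"
    and "block_diag V1 V2 \<noteq> 0"
    and "d = intdim (block_diag V1 V2)"
    and "v = max (spectral_norm V1) (spectral_norm V2)"
  shows "(\<integral>\<omega>. Z \<omega> ** ctranspose (Z \<omega>) \<partial>M)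
           = (\<Sum>k\<in>I. \<integral>\<omega>. S k \<omega> ** ctranspose (S k \<omega>) \<partial>M)
       \<and> (\<integral>\<omega>. ctranspose (Z \<omega>) ** Z \<omega> \<partial>M)
           = (\<Sum>k\<in>I. \<integral>\<omega>. ctranspose (S k \<omega>) ** S k \<omega> \<partial>M)
       \<and> (\<forall>t \<ge> sqrt v + L / 3.
            measure M {\<omega> \<in> space M. t \<le> spectral_norm (Z \<omega>)}
              \<le> 4 * d * exp ((- (t\<^sup>2 / 2)) / (v + L * t / 3)))"
proof -
  interpret prob_space M by (rule assms(1))
  note I = assms(2) and indep = assms(3) and mean = assms(4) and bd = assms(5) and Z = assms(6)
    and V = assms(7,8) and V1 = assms(9) and V2 = assms(10) and nz = assms(11) and d = assms(12)
    and v = assms(13)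
  have S: "S k \<in> borel_measurable M" if "k \<in> I" for k
    using indep that by (auto simp: indep_vars_def)
  have eq1: "(\<integral>\<omega>. Z \<omega> ** ctranspose (Z \<omega>) \<partial>M) = (\<Sum>k\<in>I. \<integral>\<omega>. S k \<omega> ** ctranspose (S k \<omega>) \<partial>M)"
    unfolding Z
    by (rule second_moment_sum[OF bounded_bilinear_outer(1) I indep])
      (auto intro: integrable_outer[OF S bd] integrable_spectral_bounded[OF S bd] mean)
  have eq2: "(\<integral>\<omega>. ctranspose (Z \<omega>) ** Z \<omega> \<partial>M) = (\<Sum>k\<in>I. \<integral>\<omega>. ctranspose (S k \<omega>) ** S k \<omega> \<partial>M)"
    unfolding Z
    by (rule second_moment_sum[OF bounded_bilinear_outer(2) I indep])
      (auto intro: integrable_outer[OF S bd] integrable_spectral_bounded[OF S bd] mean)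
  let ?e = "(Re (trace V1) + Re (trace V2)) / v"
  have psd: "0 \<le> z \<bullet> block_op V1 V2 z" for z
  proof -
    have "0 \<le> fst z \<bullet> ((\<Sum>k\<in>I. \<integral>\<omega>. S k \<omega> ** ctranspose (S k \<omega>) \<partial>M) *v fst z)"
      "0 \<le> snd z \<bullet> ((\<Sum>k\<in>I. \<integral>\<omega>. ctranspose (S k \<omega>) ** S k \<omega> \<partial>M) *v snd z)"
      unfolding linear_sum[OF bounded_linear.linear[OF bounded_linear_inner_mult]]
      by (intro sum_nonneg second_moment_inner_nonneg integrable_outer[OF S bd]; assumption)+
    then have "0 \<le> fst z \<bullet> (V1 *v fst z)" "0 \<le> snd z \<bullet> (V2 *v snd z)"
      using psd_inner_nonneg[OF V1[unfolded loewner_ge_def eq1], of "fst z"]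
        psd_inner_nonneg[OF V2[unfolded loewner_ge_def eq2], of "snd z"]
      unfolding linear_diff[OF bounded_linear.linear[OF bounded_linear_inner_mult]] by simp_all
    then show ?thesis by (simp add: block_op_def inner_prod_def)
  qed
  have block_pos: "0 < spectral_norm (block_diag V1 V2)" by (rule spectral_norm_pos[OF nz])
  have block_le: "spectral_norm (block_diag V1 V2) \<le> v"
    unfolding v by (rule spectral_norm_block_diag_le)
  have v0: "0 < v" using block_pos block_le by simp
  have trace0: "0 \<le> Re (trace V1) + Re (trace V2)"
  proof -
    have "0 \<le> op_trace (block_op V1 V2)" unfolding op_trace_def by (intro sum_nonneg psd)
    then show ?thesis by (simp add: op_trace_block_op)
  qed
  have e_le_d: "?e \<le> d"
    unfolding d intdim_def trace_block_diag plus_complex.sel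
    by (rule divide_left_mono[OF block_le trace0]) (use block_pos v0 in simp)
  have tail: "measure M {\<omega> \<in> space M. t \<le> spectral_norm (Z \<omega>)}
      \<le> 4 * d * exp ((- (t\<^sup>2 / 2)) / (v + L * t / 3))" if t: "sqrt v + L / 3 \<le> t" for t
  proof (cases "0 \<le> L")
    case True
    have "measure M {\<omega> \<in> space M. t \<le> spectral_norm (Z \<omega>)}
        \<le> 4 * ?e * exp ((- (t\<^sup>2 / 2)) / (v + L * t / 3))"
      unfolding Z
      by (rule matrix_bernstein_tail[OF I indep mean bd V V1[unfolded eq1] V2[unfolded eq2] psd v v0 True t])
    also have "\<dots> \<le> 4 * d * exp ((- (t\<^sup>2 / 2)) / (v + L * t / 3))"
      using e_le_d by (intro mult_right_mono mult_left_mono) simp_all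
    finally show ?thesis .
  next
    case False
    (* A negative bound L is possible only for the empty sum, where Z = 0. If t is positive, the event
       is empty; otherwise the right-hand side is at least 1. *)
    have "I = {}"
    proof (rule ccontr)
      assume "I \<noteq> {}"
      then obtain k where k: "k \<in> I" by blast
      have "AE \<omega> in M. 0 \<le> L"
        using bd[OF k] by eventually_elim (rule order_trans[OF spectral_norm_nonneg])
      then show False using False by simp
    qed
    then have Z0: "spectral_norm (Z \<omega>) = 0" for \<omega>
      by (simp add: Z spectral_norm_def onorm_zero)
    (* The true bound is 1. The factor 2 is lost because the trace is taken over the reals, which
       counts every eigenvalue twice; one half is enough, since the exponential below is at least 1/2. *)
    have d_half: "1 / 2 \<le> d"
    proof -
      note le_trace = norm_le_op_trace[OF self_adjoint_block_op[OF V] psd, unfolded op_trace_block_op]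
      have "spectral_norm V1 \<le> 2 * (Re (trace V1) + Re (trace V2))"
        unfolding spectral_norm_def
      proof (rule onorm_le)
        show "norm (V1 *v x) \<le> 2 * (Re (trace V1) + Re (trace V2)) * norm x" for x
          using le_trace[of "(x, 0)"] by (simp add: block_op_def)
      qed
      moreover have "spectral_norm V2 \<le> 2 * (Re (trace V1) + Re (trace V2))"
        unfolding spectral_norm_def
      proof (rule onorm_le)
        show "norm (V2 *v x) \<le> 2 * (Re (trace V1) + Re (trace V2)) * norm x" for x
          using le_trace[of "(0, x)"] by (simp add: block_op_def)
      qed
      ultimately have "v \<le> 2 * (Re (trace V1) + Re (trace V2))" by (simp add: v)
      then have "1 / 2 \<le> ?e" using v0 by (simp add: field_simps)
      then show ?thesis using e_le_d by linarith
    qed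
    show ?thesis
    proof (cases "0 < t")
      case True
      then have "{\<omega> \<in> space M. t \<le> spectral_norm (Z \<omega>)} = {}" by (auto simp: Z0)
      then have "measure M {\<omega> \<in> space M. t \<le> spectral_norm (Z \<omega>)} = 0"
        by (simp only: measure_empty)
      then show ?thesis using d_half by simp
    next
      case t0: False
      have "t\<^sup>2 \<le> (sqrt v - t) * (- t)"
        using t0 v0 mult_nonpos_nonneg[of t "sqrt v"] by (simp add: power2_eq_square algebra_simps)
      also have "\<dots> \<le> (- L / 3) * (- t)"
        using t t0 by (intro mult_right_mono) auto
      finally have "t\<^sup>2 \<le> L * t / 3" by simp
      then have w: "t\<^sup>2 \<le> v + L * t / 3" "0 < v + L * t / 3"
        using v0 zero_le_power2[of t] by linarith+
      have "t\<^sup>2 / 2 / (v + L * t / 3) \<le> 1 / 2" using w by (simp add: field_simps)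
      then have "1 / 2 \<le> 1 + (- (t\<^sup>2 / 2)) / (v + L * t / 3)" by simp
      also have "\<dots> \<le> exp ((- (t\<^sup>2 / 2)) / (v + L * t / 3))" by (rule exp_ge_add_one_self)
      finally have exp_half: "1 / 2 \<le> exp ((- (t\<^sup>2 / 2)) / (v + L * t / 3))" .
      have "(1::real) = 4 * (1 / 2) * (1 / 2)" by simp
      also have "\<dots> \<le> 4 * d * exp ((- (t\<^sup>2 / 2)) / (v + L * t / 3))"
        using d_half exp_half by (intro mult_mono) simp_all
      finally show ?thesis by (rule order_trans[OF prob_le_1])
    qed
  qed
  show ?thesis using eq1 eq2 tail by blast
qed

end
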